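(* Let $A\in\mathbb{R}^{m\times n}$ ($m\ge n$) have full column rank, and let $l > n$. Let $\Omega\in\mathbb{R}^{l\times m}$ have independent standard normal $\mathcal N(0,1)$ entries, and set $A_1 := \Omega A$. When $A_1$ has full column rank let $R_1$ be the upper triangular factor (positive diagonal) of a reduced QR decomposition of $A_1$ and $X := AR_1^{-1}$; otherwise set $\operatorname{cond}(X) := +\infty$. Then $$\mathbb{P}\left[\operatorname{cond}(X) \ge \frac{3 + \sqrt{n/l}}{1-\sqrt{n/l}}\right] \le 2\exp\!\left(-\frac{(\sqrt l - \sqrt n)^2}{8}\right).$$
   Context: For a full column rank matrix $M$, $\operatorname{cond}(M) = \sigma_{\max}(M)/\sigma_{\min}(M)$, the ratio of its largest and smallest (i.e. $n$-th) singular values. *)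

theory Defs
  imports "HOL-Analysis.Analysis" "HOL-Probability.Probability"
begin

text \<open>Singular values of a real matrix X (m x n, columns indexed by 'n): the square roots
  of the eigenvalues of X^T X (as a set; multiplicities are irrelevant for max/min).\<close>
definition sing_vals :: "real^'n^'m \<Rightarrow> real set" where
  "sing_vals X = {sqrt \<mu> | \<mu>. \<exists>v. v \<noteq> 0 \<and> (transpose X ** X) *v v = \<mu> *\<^sub>R v}"

definition cond :: "real^'n^'m \<Rightarrow> real" where
  "cond X = Max (sing_vals X) / Min (sing_vals X)"

definition upper_triangular :: "real^('n::{finite,wellorder})^('n::{finite,wellorder}) \<Rightarrow> bool" where
  "upper_triangular R \<longleftrightarrow> (\<forall>i j. j < i \<longrightarrow> R $ i $ j = 0)"

text \<open>R factor of the reduced QR decomposition B = Q R (Q with orthonormal columns,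
  R upper triangular with positive diagonal); unique when B has full column rank.\<close>
definition qr_R :: "real^('n::{finite,wellorder})^'l \<Rightarrow> real^('n::{finite,wellorder})^('n::{finite,wellorder})" where
  "qr_R B = (THE R. upper_triangular R \<and> (\<forall>i. R $ i $ i > 0) \<and>
      (\<exists>Q :: real^('n::{finite,wellorder})^'l. transpose Q ** Q = mat 1 \<and> B = Q ** R))"

definition sketch_cond :: "real^('n::{finite,wellorder})^'m \<Rightarrow> real^'m^'l \<Rightarrow> ereal" where
  "sketch_cond A \<Omega> = (if rank (\<Omega> ** A) = CARD('n)
      then ereal (cond (A ** matrix_inv (qr_R (\<Omega> ** A)))) else \<infinity>)"

end

theory Submission
  imports Defs
begin

text \<open>
  Let \<open>B\<close> be an isometry of \<open>\<real>\<^sup>n\<close> onto the range of \<open>A\<close>. As \<open>\<Omega> X\<close> has orthonormal columns, \<open>cond X\<close>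
  is the ratio of the largest to the smallest value of \<open>norm (\<Omega> (B u))\<close> over unit vectors \<open>u\<close>, so it
  suffices that neither the largest value exceeds some \<open>a\<close> nor the smallest falls below some \<open>b\<close>, where
  \<open>a / b\<close> is the threshold of the theorem.

  Instead of Gaussian comparison and concentration, both tails are bounded by a moment method with an
  auxiliary independent Gaussian direction \<open>w \<in> \<real>\<^sup>n\<close>. If the largest value is at least \<open>a\<close>, then
  \<open>norm (\<Omega> (B w))\<close> dominates \<open>a\<close> times a standard normal variable, while for fixed \<open>w\<close> it is \<open>norm w\<close>
  times the norm of an \<open>l\<close>-dimensional Gaussian vector. If the smallest value is at most \<open>b\<close>, then the
  distance of \<open>\<Omega> (B w) / norm w\<close> from the image of the hyperplane orthogonal to \<open>w\<close> is at most
  \<open>b * norm w\<close> divided by the absolute value of a standard normal variable, while for fixed \<open>w\<close> it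
  dominates a chi variable with \<open>l - n + 1\<close> degrees of freedom. Comparing moments of order \<open>2 p\<close>,
  respectively \<open>- 2 p\<close>, bounds the probabilities, and a suitable choice of \<open>a\<close>, \<open>b\<close> and \<open>p\<close> makes
  both of them at most \<open>exp (- (sqrt l - sqrt n)\<^sup>2 / 8)\<close> unless the claim is trivial.
\<close>

section \<open>Exponents of the moment bounds\<close>

text \<open>The extremal direction depends on \<open>\<Omega>\<close>, so the law of the gain in a
  fixed direction says nothing about it directly. The auxiliary \<open>w\<close> removes this
  obstacle: with the matrix fixed the extremal vector is a constant and \<open>w\<close> is averaged
  out, and after exchanging the integrals \<open>w\<close> is the constant. Write
  \<open>r = sqrt n\<close>, \<open>s = sqrt l\<close>, \<open>d = l - n\<close>. The threshold
  \<open>(3 * s + r) / (s - r)\<close> prescribes only \<open>a / b\<close>, which leaves one free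
  parameter. It is chosen so that the optimal negative moment order has the closed form
  \<open>Q = (s - r) * (3/4 * s + r)\<close>: then
  \<open>r\<^sup>2 + Q = s * (3 * s + r) / 4\<close> and \<open>d - Q = s * (s - r) / 4\<close>, so
  all logarithms split into simple factors and, after scaling, only \<open>t = r / s\<close>
  remains. Orders must be even integers, so the exponent estimates need slack for rounding. It
  suffices when \<open>(s - r)\<^sup>2 \<ge> 8 * ln 2\<close>, that is, when the claimed bound is at
  most 1; otherwise there is nothing to prove.\<close>

lemma ln_2_lower: "ln (2::real) \<ge> 6913 / 10000"
proof -
  \<comment> \<open>The remainder of the series of \<open>ln ((1 + x) / (1 - x))\<close> after two
    terms. At \<open>x = 1/3\<close> the logarithm is \<open>ln 2\<close> and the two terms sum to
    56/81 = 0.69135...\<close>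
  define h where "h = (\<lambda>x::real. ln (1 + x) - ln (1 - x) - 2 * x - 2 * x^3 / 3)"
  have "h 0 \<le> h (1/3)"
  proof (rule DERIV_nonneg_imp_nondecreasing[of 0 "1/3" h])
    fix x :: real assume x: "0 \<le> x" "x \<le> 1/3"
    have "(h has_real_derivative (1 / (1 + x) + 1 / (1 - x) - 2 - 2 * x^2)) (at x)"
      unfolding h_def using x by (auto intro!: derivative_eq_intros simp: power2_eq_square)
    moreover have "1 / (1 + x) + 1 / (1 - x) - 2 - 2 * x^2 = 2 * x^4 / (1 - x^2)"
    proof -
      have "x * x \<le> (1/3) * (1/3)" using x by (intro mult_mono) auto
      then have "1 + x \<noteq> 0" "1 - x \<noteq> 0" "1 - x^2 \<noteq> 0"
        using x by (auto simp: power2_eq_square)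
      moreover have "1 - x^2 = (1 + x) * (1 - x)" by (simp add: algebra_simps power2_eq_square)
      ultimately show ?thesis
        by (simp add: divide_simps) (simp add: algebra_simps power2_eq_square power4_eq_xxxx)
    qed
    moreover have "2 * x^4 / (1 - x^2) \<ge> 0" using x by (simp add: power_le_one)
    ultimately show "\<exists>y. (h has_real_derivative y) (at x) \<and> 0 \<le> y" by metis
  qed simp
  moreover have "h (1/3) = ln (4/3) - ln (2/3) - 2/3 - 2/81" by (simp add: h_def field_simps)
  moreover have "ln (4/3::real) - ln (2/3) = ln 2" using ln_div[of "4/3::real" "2/3"] by simp
  ultimately show ?thesis by (simp add: h_def)
qed

text \<open>Since \<open>x * ln x - x\<close> is a primitive of \<open>ln\<close>, the left side is
  the integral of \<open>ln\<close> over \<open>[c - 1, c + 1]\<close> plus 2, and concavity bounds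
  the integral by twice the value at the midpoint. At \<open>c = 1\<close> the term
  \<open>0 * ln 0\<close> is 0, in agreement with the limit.\<close>

lemma mul_ln_midpoint:
  fixes c :: real
  assumes "c \<ge> 1"
  shows "(c + 1) * ln (c + 1) - (c - 1) * ln (c - 1) \<le> 2 * ln c + 2"
proof (cases "c = 1")
  case True
  then show ?thesis using ln_2_less_1 by simp
next
  case False
  define g where "g = (\<lambda>x::real. (1 + x) * ln (1 + x) - (1 - x) * ln (1 - x) - 2 * x)"
  have c: "c > 1" using False assms by simp
  have "g (1 / c) \<le> g 0"
  proof (rule DERIV_nonpos_imp_nonincreasing[of 0 "1 / c" g])
    fix x :: real assume x: "0 \<le> x" "x \<le> 1 / c"
    have x1: "x < 1" using x c by (smt (verit) divide_less_eq_1_pos)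
    have "(g has_real_derivative (ln (1 + x) + ln (1 - x))) (at x)"
      unfolding g_def using x x1 by (auto intro!: derivative_eq_intros)
    moreover have "ln (1 + x) + ln (1 - x) \<le> 0"
      using x x1 ln_add_one_self_le_self[of x] ln_le_minus_one[of "1 - x"] by simp
    ultimately show "\<exists>y. (g has_real_derivative y) (at x) \<and> y \<le> 0" by blast
  qed (use c in simp)
  then have "c * g (1 / c) \<le> 0" using c by (simp add: g_def mult_nonneg_nonpos)
  moreover have "ln (1 + 1 / c) = ln (c + 1) - ln c" "ln (1 - 1 / c) = ln (c - 1) - ln c"
  proof -
    have "1 + 1 / c = (c + 1) / c" "1 - 1 / c = (c - 1) / c" using c by (auto simp: field_simps)
    then show "ln (1 + 1 / c) = ln (c + 1) - ln c" "ln (1 - 1 / c) = ln (c - 1) - ln c"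
      using c by (simp_all only: ln_div[of "c + 1" c] ln_div[of "c - 1" c]) (use c in \<open>auto simp: ln_div\<close>)
  qed
  ultimately have "c * ((1 + 1 / c) * (ln (c + 1) - ln c) - (1 - 1 / c) * (ln (c - 1) - ln c) - 2 * (1 / c)) \<le> 0"
    by (simp add: g_def)
  moreover have "c * (1 + 1 / c) = c + 1" "c * (1 - 1 / c) = c - 1" "c * (2 * (1 / c)) = 2"
    using c by (auto simp: field_simps)
  ultimately have "(c + 1) * (ln (c + 1) - ln c) - (c - 1) * (ln (c - 1) - ln c) - 2 \<le> 0"
    by (simp only: right_diff_distrib mult.assoc[symmetric])
  then show ?thesis by (simp add: algebra_simps)
qed

text \<open>The right side is the product of the odd numbers below \<open>2 * p\<close>, the moment
  of order \<open>2 * p\<close> of a standard normal variable. The odd factors are the midpoints of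
  intervals of length 2 that tile \<open>[0, 2 * p]\<close>, and \<open>mul_ln_midpoint\<close>
  applies to each.\<close>

lemma fact_double_ratio_ge:
  "exp (((2 * real p) * ln (2 * real p) - 2 * real p) / 2) \<le> fact (2 * p) / (2 ^ p * fact p)"
proof (induction p)
  case 0
  then show ?case by simp
next
  case (Suc p)
  define c where "c = 2 * real p + 1"
  have c: "c \<ge> 1" by (simp add: c_def)
  have "exp (((2 * real (Suc p)) * ln (2 * real (Suc p)) - 2 * real (Suc p)) / 2)
      = exp (((c + 1) * ln (c + 1) - (c + 1)) / 2)" by (simp add: c_def add_ac)
  also have "\<dots> \<le> exp (((c - 1) * ln (c - 1) - (c - 1)) / 2 + ln c)"
    using mul_ln_midpoint[OF c] by (simp add: field_simps)
  also have "\<dots> = exp (((2 * real p) * ln (2 * real p) - 2 * real p) / 2) * c"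
    using c by (simp add: exp_add c_def)
  also have "\<dots> \<le> fact (2 * p) / (2 ^ p * fact p) * c"
    using Suc c by (intro mult_right_mono) auto
  also have "\<dots> = fact (2 * Suc p) / (2 ^ Suc p * fact (Suc p))"
  proof -
    have "(2 * real p + 2) = 2 * (real p + 1)" by simp
    then show ?thesis by (simp add: c_def divide_simps)
  qed
  finally show ?case .
qed

text \<open>The factors \<open>d - 1\<close>, \<open>d - 3\<close>, ... are the midpoints of
  intervals of length 2 that tile \<open>[d - 2 * p, d]\<close>. Their product is the reciprocal of
  the moment of order \<open>- 2 * p\<close> of a chi variable with \<open>d + 1\<close> degrees of
  freedom.\<close>

lemma prod_arith_progression_ge:
  fixes d :: real
  assumes "2 * real p \<le> d"
  shows "exp ((d * ln d - (d - 2 * real p) * ln (d - 2 * real p) - 2 * real p) / 2)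
     \<le> (\<Prod>j=1..p. d + 1 - 2 * real j)"
  using assms
proof (induction p)
  case 0
  then show ?case by simp
next
  case (Suc p)
  define c where "c = d - 2 * real p - 1"
  have c: "c \<ge> 1" using Suc.prems by (simp add: c_def)
  have "exp ((d * ln d - (d - 2 * real (Suc p)) * ln (d - 2 * real (Suc p)) - 2 * real (Suc p)) / 2)
     = exp ((d * ln d - (c - 1) * ln (c - 1) - 2 * real p - 2) / 2)" by (simp add: c_def algebra_simps)
  also have "\<dots> \<le> exp ((d * ln d - (c + 1) * ln (c + 1) - 2 * real p) / 2 + ln c)"
    using mul_ln_midpoint[OF c] by (simp add: field_simps)
  also have "\<dots> = exp ((d * ln d - (d - 2 * real p) * ln (d - 2 * real p) - 2 * real p) / 2) * c"
    using c by (simp add: exp_add c_def)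
  also have "\<dots> \<le> (\<Prod>j=1..p. d + 1 - 2 * real j) * c"
    using Suc c by (intro mult_right_mono) auto
  also have "\<dots> = (\<Prod>j=1..Suc p. d + 1 - 2 * real j)" by (simp add: c_def)
  finally show ?case .
qed

text \<open>Here \<open>r\<^sup>2 = n\<close>, \<open>s\<^sup>2 = l\<close> and \<open>P = 2 p\<close>. For fixed \<open>a\<close> the bound is optimal at a root of
  \<open>(n + P) * (l + P) = P * a\<^sup>2\<close>; the interval allowed for \<open>P\<close> lies between the two roots for
  \<open>a\<^sup>2 = (3 * s + r) * (3 * s + 4 * r) / 4\<close>, and it has length at least 2 in the nontrivial case, so that it
  contains an even integer.\<close>
lemma largest_gain_exponent:
  fixes r s P :: real
  assumes r: "0 < r" "r \<le> s"
    and P: "s * (5/4 * s + 29/10 * r) \<le> P" "P \<le> s * (5/4 * s + 7/2 * r)"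
  shows "((r\<^sup>2 + P) * ln (r\<^sup>2 + P) - r\<^sup>2 * ln (r\<^sup>2) - P) + ((s\<^sup>2 + P) * ln (s\<^sup>2 + P) - s\<^sup>2 * ln (s\<^sup>2) - P)
     - (P * ln P - P) - P * ln ((3 * s + r) * (3 * s + 4 * r) / 4) \<le> - (s - r)\<^sup>2 / 4"
proof -
  define t x where "t = r / s" and "x = P / s\<^sup>2"
  have s: "s > 0" using r by simp
  have t: "0 < t" "t \<le> 1" using r s by (auto simp: t_def)
  have rt: "r = t * s" and Px: "P = x * s\<^sup>2" using s by (auto simp: t_def x_def)
  have x: "5/4 + 29/10 * t \<le> x" "x \<le> 5/4 + 7/2 * t"
  proof -
    have "s\<^sup>2 * (5/4 + 29/10 * t) \<le> s\<^sup>2 * x" "s\<^sup>2 * x \<le> s\<^sup>2 * (5/4 + 7/2 * t)"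
      using P s by (simp_all add: x_def t_def algebra_simps power2_eq_square)
    then show "5/4 + 29/10 * t \<le> x" "x \<le> 5/4 + 7/2 * t" using s by simp_all
  qed
  have x0: "x > 0" using x t by simp
  have a: "(r\<^sup>2 + P) = s\<^sup>2 * (t\<^sup>2 + x)" "s\<^sup>2 + P = s\<^sup>2 * (1 + x)"
     "(3 * s + r) * (3 * s + 4 * r) / 4 = s\<^sup>2 * ((3 + t) * (3 + 4 * t) / 4)" "r\<^sup>2 = s\<^sup>2 * t\<^sup>2"
    by (simp_all add: rt Px algebra_simps power2_eq_square)
  have pos: "t\<^sup>2 + x > 0" "1 + x > 0" "(3 + t) * (3 + 4 * t) / 4 > 0" "t\<^sup>2 > 0"
    using t x0 by (auto intro!: add_nonneg_pos)
  have main: "(t\<^sup>2 + x) * ln (t\<^sup>2 + x) - t\<^sup>2 * ln (t\<^sup>2) + (1 + x) * ln (1 + x) - x * ln x - x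
      - x * ln ((3 + t) * (3 + 4 * t) / 4) \<le> - (1 - t)\<^sup>2 / 4"
  proof -
    \<comment> \<open>The logarithmic terms of \<open>main\<close> with factor \<open>x\<close> add
      up to \<open>x\<close> times the logarithm of the quotient of these two sides, hence to at
      most 0. What is left is \<open>t\<^sup>2 * (ln (t\<^sup>2 + x) - ln (t\<^sup>2)) + ln (1 + x)
      - x\<close>.\<close>
    have "(t\<^sup>2 + x) * (1 + x) / x \<le> (3 + t) * (3 + 4 * t) / 4"
    proof -
      have "4 * t \<le> x" using x t by simp
      then have "t * (4 * t) \<le> t * x" using t by (intro mult_left_mono) auto
      moreover have "x * x \<le> x * (5/4 + 7/2 * t)" using x x0 by (intro mult_left_mono) auto
      ultimately show ?thesis using x0 by (simp add: field_simps power2_eq_square)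
    qed
    then have "ln ((t\<^sup>2 + x) * (1 + x) / x) \<le> ln ((3 + t) * (3 + 4 * t) / 4)"
      using pos x0 by (subst ln_le_cancel_iff) (auto intro!: divide_pos_pos mult_pos_pos add_nonneg_pos)
    then have "ln (t\<^sup>2 + x) + ln (1 + x) - ln x \<le> ln ((3 + t) * (3 + 4 * t) / 4)"
      using pos x0 by (simp add: ln_div ln_mult)
    then have 1: "x * (ln (t\<^sup>2 + x) + ln (1 + x) - ln x) \<le> x * ln ((3 + t) * (3 + 4 * t) / 4)"
      using x0 by (intro mult_left_mono) auto
    \<comment> \<open>A square above \<open>t\<^sup>2 + x\<close> on the whole allowed range of
      \<open>x\<close>. Below, \<open>ln 2\<close> is split off so that the remaining argument
      \<open>(t + 7/5) / (2 * t)\<close> is close to 1 for \<open>t\<close> near 1.\<close>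
    have "ln (t\<^sup>2 + x) \<le> ln ((t + 7/5)\<^sup>2)"
      using x t pos by (subst ln_le_cancel_iff) (auto simp: power2_eq_square algebra_simps)
    also have "\<dots> = 2 * ln (t + 7/5)" using t by (simp add: ln_realpow)
    finally have "ln (t\<^sup>2 + x) - ln (t\<^sup>2) \<le> 2 * (ln (t + 7/5) - ln t)" using t by (simp add: ln_realpow)
    also have "ln (t + 7/5) - ln t = ln 2 + ln ((t + 7/5) / (2 * t))" using t by (simp add: ln_div ln_mult)
    also have "\<dots> \<le> 25/36 + ((t + 7/5) / (2 * t) - 1)"
      using t ln2_le_25_over_36 by (intro add_mono ln_le_minus_one) auto
    finally have "t\<^sup>2 * (ln (t\<^sup>2 + x) - ln (t\<^sup>2)) \<le> t\<^sup>2 * (2 * (25/36 + ((t + 7/5) / (2 * t) - 1)))"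
      by (intro mult_left_mono) auto
    also have "\<dots> = t\<^sup>2 * (14/36) + 7/5 * t" using t by (simp add: field_simps power2_eq_square)
    finally have 2: "t\<^sup>2 * (ln (t\<^sup>2 + x) - ln (t\<^sup>2)) \<le> t\<^sup>2 * (14/36) + 7/5 * t" .
    \<comment> \<open>\<open>y\<close> is \<open>1 + x\<close> at the lower end of the allowed
      range; \<open>ln (1 + x) - x\<close> decreases in \<open>x\<close>, so this end is the
      worst.\<close>
    define y where "y = 9/4 + 29/10 * t"
    have "ln (1 + x) - ln y = ln ((1 + x) / y)" using t x0 by (simp add: ln_div y_def)
    also have "\<dots> \<le> (1 + x) / y - 1" using t x0 by (intro ln_le_minus_one) (auto simp: y_def)
    also have "\<dots> = (1 + x - y) / y" using t by (simp add: y_def field_simps)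
    also have "\<dots> \<le> 1 + x - y" using mult_left_mono[of 1 y "1 + x - y"] t x by (simp add: y_def divide_le_eq)
    finally have 3: "ln (1 + x) - x \<le> ln y - y + 1" by simp
    have "ln y = ln (9/4) + ln (y / (9/4))" using t ln_mult[of "9/4" "y / (9/4)"] unfolding y_def by (simp only: times_divide_eq_right nonzero_mult_div_cancel_left) simp
    also have "\<dots> \<le> 1 + (y / (9/4) - 1)"
    proof (intro add_mono ln_le_minus_one)
      have "ln (9/4 :: real) = 2 * ln (3/2)" using ln_realpow[of "3/2::real" 2] by (simp add: power2_eq_square)
      also have "\<dots> \<le> 2 * (3/2 - 1)" by (intro mult_left_mono ln_le_minus_one) auto
      finally show "ln (9/4::real) \<le> 1" by simp
    qed (use t in \<open>auto simp: y_def\<close>)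
    finally have 4: "ln y - y + 1 \<le> - 1/4 + (116/90 - 29/10) * t" by (simp add: y_def algebra_simps)
    have "t\<^sup>2 \<le> t" using t by (simp add: power2_eq_square mult_left_le)
    moreover have "x * (ln (t\<^sup>2 + x) + ln (1 + x) - ln x) = x * ln (t\<^sup>2 + x) + x * ln (1 + x) - x * ln x"
      "t\<^sup>2 * (ln (t\<^sup>2 + x) - ln (t\<^sup>2)) = t\<^sup>2 * ln (t\<^sup>2 + x) - t\<^sup>2 * ln (t\<^sup>2)"
      "(t\<^sup>2 + x) * ln (t\<^sup>2 + x) = t\<^sup>2 * ln (t\<^sup>2 + x) + x * ln (t\<^sup>2 + x)"
      "(1 + x) * ln (1 + x) = ln (1 + x) + x * ln (1 + x)" "(1 - t)\<^sup>2 = 1 - 2 * t + t\<^sup>2"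
      by (simp_all add: algebra_simps power2_eq_square)
    ultimately show ?thesis using 1 2 3 4 t(1) by argo
  qed
  define L1 where "L1 = ln (t\<^sup>2 + x)"
  define L2 where "L2 = ln (1 + x)"
  define L3 where "L3 = ln ((3 + t) * (3 + 4 * t) / 4)"
  define L4 where "L4 = ln (t\<^sup>2)"
  note Ls = L1_def L2_def L3_def L4_def
  have l: "ln (s\<^sup>2 * (t\<^sup>2 + x)) = ln (s\<^sup>2) + L1" "ln (s\<^sup>2 * (1 + x)) = ln (s\<^sup>2) + L2"
    "ln (s\<^sup>2 * ((3 + t) * (3 + 4 * t) / 4)) = ln (s\<^sup>2) + L3" "ln (s\<^sup>2 * t\<^sup>2) = ln (s\<^sup>2) + L4"
    "ln (x * s\<^sup>2) = ln x + ln (s\<^sup>2)"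
    "ln (t\<^sup>2 + x) = L1" "ln (1 + x) = L2" "ln ((3 + t) * (3 + 4 * t) / 4) = L3" "ln (t\<^sup>2) = L4"
    unfolding Ls using pos s x0 by (simp_all only: ln_mult_pos zero_less_power refl)
  have "((r\<^sup>2 + P) * ln (r\<^sup>2 + P) - r\<^sup>2 * ln (r\<^sup>2) - P) + ((s\<^sup>2 + P) * ln (s\<^sup>2 + P) - s\<^sup>2 * ln (s\<^sup>2) - P)
     - (P * ln P - P) - P * ln ((3 * s + r) * (3 * s + 4 * r) / 4)
   = s\<^sup>2 * ((t\<^sup>2 + x) * ln (t\<^sup>2 + x) - t\<^sup>2 * ln (t\<^sup>2) + (1 + x) * ln (1 + x) - x * ln x - x
      - x * ln ((3 + t) * (3 + 4 * t) / 4))"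
    unfolding l[folded a Px] l by (simp add: Px rt algebra_simps power2_eq_square)
  also have "\<dots> \<le> s\<^sup>2 * (- (1 - t)\<^sup>2 / 4)" by (intro mult_left_mono main) auto
  also have "\<dots> = - (s - r)\<^sup>2 / 4" by (simp add: rt algebra_simps power2_eq_square)
  finally show ?thesis .
qed

text \<open>With \<open>d = l - n\<close>, the optimality condition for \<open>Q = 2 p\<close> is \<open>Q * (d - Q) = b\<^sup>2 * (n + Q)\<close>; the chosen
  \<open>Q\<close> and \<open>b\<^sup>2 = (s - r)\<^sup>2 * (3 * s + 4 * r) / (4 * (3 * s + r))\<close> satisfy it. The last summand on the
  right is the slack that pays for rounding \<open>Q\<close> down to an even integer.\<close>
lemma smallest_gain_exponent_at_optimum:
  fixes r s :: real
  assumes r: "0 < r" "r < s"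
  defines "Q \<equiv> (s - r) * (3/4 * s + r)" and "d \<equiv> s\<^sup>2 - r\<^sup>2"
  shows "((r\<^sup>2 + Q) * ln (r\<^sup>2 + Q) - r\<^sup>2 * ln (r\<^sup>2) - Q) - (Q * ln Q - Q)
     - (d * ln d - (d - Q) * ln (d - Q) - Q) + Q * ln ((s - r)\<^sup>2 * (3 * s + 4 * r) / (4 * (3 * s + r)))
     \<le> - (s - r)\<^sup>2 / 4 - 53/200 * (s * (s - r))"
proof -
  define t where "t = r / s"
  have s: "s > 0" using r by simp
  have t: "0 < t" "t < 1" using r s by (auto simp: t_def)
  have rt: "r = t * s" using s by (auto simp: t_def)
  have a: "(r\<^sup>2 + Q) = s\<^sup>2 * ((3 + t) / 4)" "Q = s\<^sup>2 * ((1 - t) * (3 + 4 * t) / 4)"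
     "d = s\<^sup>2 * ((1 - t) * (1 + t))" "d - Q = s\<^sup>2 * ((1 - t) / 4)" "r\<^sup>2 = s\<^sup>2 * t\<^sup>2"
    by (simp_all add: rt Q_def d_def field_simps power2_eq_square)
  have b: "(s - r)\<^sup>2 * (3 * s + 4 * r) / (4 * (3 * s + r)) = s\<^sup>2 * ((1 - t)\<^sup>2 * (3 + 4 * t) / (4 * (3 + t)))"
  proof -
    have "(s - r)\<^sup>2 * (3 * s + 4 * r) / (4 * (3 * s + r)) = (s * (s\<^sup>2 * ((1 - t)\<^sup>2 * (3 + 4 * t)))) / (s * (4 * (3 + t)))"
      by (simp add: rt algebra_simps power2_eq_square)
    then show ?thesis using s by simp
  qed
  have pos: "3 + t > 0" "1 - t > 0" "3 + 4 * t > 0" "1 + t > 0" "t > 0" using t by auto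
  have main: "t\<^sup>2 * (ln (3 + t) - ln 4 - 2 * ln t) - (1 - t) * (1 + t) * (ln 4 + ln (1 + t)) + (1 - t) * (3 + 4 * t) / 4
     \<le> - (1 - t)\<^sup>2 / 4 - 53/200 * (1 - t)"
  proof -
    \<comment> \<open>The bound \<open>(7 + t) / 8\<close> for \<open>q\<close> is its tangent at
      \<open>t = 1\<close>; with it a factor \<open>1 - t\<close> comes out exactly.\<close>
    define q where "q = sqrt ((3 + t) / 4)"
    have q: "q > 0" "q\<^sup>2 = (3 + t) / 4" using t by (auto simp: q_def)
    have "q \<le> (7 + t) / 8" unfolding q_def
      by (rule real_le_lsqrt) (use t zero_le_power2[of "t - 1"] in \<open>auto simp: power2_eq_square field_simps\<close>)
    have "ln (3 + t) - ln 4 - 2 * ln t = 2 * ln (q / t)"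
    proof -
      have "2 * ln q = ln (q\<^sup>2)" using q by (simp add: ln_realpow)
      then show ?thesis using q t by (simp add: ln_div)
    qed
    also have "\<dots> \<le> 2 * (q / t - 1)" using q t by (intro mult_left_mono ln_le_minus_one) auto
    also have "\<dots> \<le> 2 * ((7 + t) / 8 / t - 1)" using \<open>q \<le> _\<close> t by (intro mult_left_mono diff_right_mono divide_right_mono) auto
    finally have "t\<^sup>2 * (ln (3 + t) - ln 4 - 2 * ln t) \<le> t\<^sup>2 * (2 * ((7 + t) / 8 / t - 1))" by (intro mult_left_mono) auto
    also have "\<dots> = (1 - t) * (7/4 * t)" using t by (simp add: field_simps power2_eq_square)
    finally have 1: "t\<^sup>2 * (ln (3 + t) - ln 4 - 2 * ln t) \<le> (1 - t) * (7/4 * t)" .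
    have "- ln (1 + t) \<le> 1 / (1 + t) - 1" using ln_le_minus_one[of "1 / (1 + t)"] t by (simp add: ln_div)
    then have "(1 + t) * (- ln (1 + t)) \<le> (1 + t) * (1 / (1 + t) - 1)" using t by (intro mult_left_mono) auto
    also have "\<dots> = - t" using t by (simp add: field_simps)
    finally have 2: "t \<le> (1 + t) * ln (1 + t)" by simp
    have "ln (4::real) = 2 * ln 2" using ln_realpow[of "2::real" 2] by simp
    then have 3: "(1 + t) * (13826/10000) \<le> (1 + t) * ln 4" using ln_2_lower t by (intro mult_left_mono) auto
    \<comment> \<open>With the common factor \<open>1 - t\<close> removed, the bounds are affine in
      \<open>t\<close>. At \<open>t = 1\<close> they leave a margin of only 0.0002, which explains
      both the precision required of \<open>ln 2\<close> and the constant 53/200.\<close>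
    have "7/4 * t - (1 + t) * (ln 4 + ln (1 + t)) + (3 + 4 * t) / 4 + (1 - t) / 4 + 53/200 \<le> 0"
    proof -
      have "(1 + t) * (ln 4 + ln (1 + t)) = (1 + t) * ln 4 + (1 + t) * ln (1 + t)" by (rule distrib_left)
      then show ?thesis using 2 3 t by argo
    qed
    then have "(1 - t) * (7/4 * t - (1 + t) * (ln 4 + ln (1 + t)) + (3 + 4 * t) / 4 + (1 - t) / 4 + 53/200) \<le> 0"
      using t by (intro mult_nonneg_nonpos) auto
    then have "(1 - t) * (7/4 * t) - (1 - t) * (1 + t) * (ln 4 + ln (1 + t)) + (1 - t) * (3 + 4 * t) / 4
      \<le> - (1 - t)\<^sup>2 / 4 - 53/200 * (1 - t)"
      by (simp add: field_simps power2_eq_square)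
    with 1 show ?thesis by linarith
  qed
  define L where "L = ln s"
  define L0 where "L0 = ln t"
  define L1 where "L1 = ln (1 - t)"
  define L2 where "L2 = ln (1 + t)"
  define L3 where "L3 = ln (3 + t)"
  define L4 where "L4 = ln (4 :: real)"
  define L5 where "L5 = ln (3 + 4 * t)"
  note Ls = L_def L0_def L1_def L2_def L3_def L4_def L5_def
  have l: "ln (s\<^sup>2 * ((3 + t) / 4)) = 2 * L + L3 - L4" "ln (s\<^sup>2 * ((1 - t) * (3 + 4 * t) / 4)) = 2 * L + L1 + L5 - L4"
    "ln (s\<^sup>2 * ((1 - t) * (1 + t))) = 2 * L + L1 + L2" "ln (s\<^sup>2 * ((1 - t) / 4)) = 2 * L + L1 - L4"
    "ln (s\<^sup>2 * t\<^sup>2) = 2 * L + 2 * L0"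
    "ln (s\<^sup>2 * ((1 - t)\<^sup>2 * (3 + 4 * t) / (4 * (3 + t)))) = 2 * L + 2 * L1 + L5 - L4 - L3"
    "ln (3 + t) = L3" "ln 4 = L4" "ln t = L0" "ln (1 + t) = L2"
    unfolding Ls using pos s by (simp_all add: ln_mult ln_realpow ln_div del: times_divide_eq_right distrib_left_numeral)
  have "((r\<^sup>2 + Q) * ln (r\<^sup>2 + Q) - r\<^sup>2 * ln (r\<^sup>2) - Q) - (Q * ln Q - Q)
     - (d * ln d - (d - Q) * ln (d - Q) - Q) + Q * ln ((s - r)\<^sup>2 * (3 * s + 4 * r) / (4 * (3 * s + r)))
    = s\<^sup>2 * (t\<^sup>2 * (ln (3 + t) - ln 4 - 2 * ln t) - (1 - t) * (1 + t) * (ln 4 + ln (1 + t)) + (1 - t) * (3 + 4 * t) / 4)"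
    unfolding b l[folded a] l unfolding a by (simp add: field_simps power2_eq_square)
  also have "\<dots> \<le> s\<^sup>2 * (- (1 - t)\<^sup>2 / 4 - 53/200 * (1 - t))" by (intro mult_left_mono main) auto
  also have "\<dots> = - (s - r)\<^sup>2 / 4 - 53/200 * (s * (s - r))" by (simp add: rt algebra_simps power2_eq_square)
  finally show ?thesis .
qed

text \<open>Rounding to an even integer moves the order down by less than 2. The derivative of the
  exponent vanishes at \<open>Q\<^sub>0\<close>, so by the mean value theorem the loss is at most
  \<open>16 / (s * (s - r))\<close>, and \<open>big\<close> together with \<open>1 \<le> r\<close>
  makes \<open>s * (s - r)\<close> large enough for the slack in
  \<open>smallest_gain_exponent_at_optimum\<close> to cover it.\<close>

lemma smallest_gain_exponent:
  fixes r s Q :: real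
  assumes r: "1 \<le> r" "r < s" and big: "(s - r)\<^sup>2 \<ge> 8 * ln 2"
  defines "Q\<^sub>0 \<equiv> (s - r) * (3/4 * s + r)" and "d \<equiv> s\<^sup>2 - r\<^sup>2"
  assumes Q: "Q\<^sub>0 - 2 < Q" "Q \<le> Q\<^sub>0"
  shows "((r\<^sup>2 + Q) * ln (r\<^sup>2 + Q) - r\<^sup>2 * ln (r\<^sup>2) - Q) - (Q * ln Q - Q)
     - (d * ln d - (d - Q) * ln (d - Q) - Q) + Q * ln ((s - r)\<^sup>2 * (3 * s + 4 * r) / (4 * (3 * s + r)))
     \<le> - (s - r)\<^sup>2 / 4" and "2 < Q" and "Q < d"
proof -
  define B where "B = (s - r)\<^sup>2 * (3 * s + 4 * r) / (4 * (3 * s + r))"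
  define J where "J = (\<lambda>Q. ((r\<^sup>2 + Q) * ln (r\<^sup>2 + Q) - r\<^sup>2 * ln (r\<^sup>2) - Q) - (Q * ln Q - Q)
     - (d * ln d - (d - Q) * ln (d - Q) - Q) + Q * ln B)"
  \<comment> \<open>\<open>2349/1000\<close> is slightly below \<open>sqrt (8 * ln 2)\<close>,
    computed with the lower bound 6913/10000 for \<open>ln 2\<close>.\<close>
  have sr: "s - r \<ge> 2349/1000"
  proof (rule power2_le_imp_le)
    show "(2349/1000)\<^sup>2 \<le> (s - r)\<^sup>2" using big ln_2_lower by (simp add: power2_eq_square)
  qed (use r in simp)
  have s: "s \<ge> 3349/1000" using sr r by simp
  have m: "s * (s - r) \<ge> (3349/1000) * (2349/1000)" using s sr by (intro mult_mono) auto
  have D0: "d - Q\<^sub>0 = s * (s - r) / 4" by (simp add: d_def Q\<^sub>0_def field_simps power2_eq_square)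
  have D0pos: "d - Q\<^sub>0 > 0" using m unfolding D0 by simp
  have "(s - r) * (3/4 * s + r) \<ge> (2349/1000) * (3/4 * (3349/1000) + 1)" using s sr r by (intro mult_mono add_mono) auto
  then have Q0: "Q\<^sub>0 > 4" by (simp add: Q\<^sub>0_def)
  then show "2 < Q" using Q by simp
  show "Q < d" using D0pos Q by simp
  have Bpos: "B > 0" using r by (auto simp: B_def)
  \<comment> \<open>Stationarity of \<open>J\<close> at \<open>Q\<^sub>0\<close>: its derivative at
    \<open>x\<close> is the logarithm of \<open>B * (r\<^sup>2 + x) / (x * (d - x))\<close>.\<close>
  have Beq: "B * (r\<^sup>2 + Q\<^sub>0) = Q\<^sub>0 * (d - Q\<^sub>0)"
  proof -
    have "r\<^sup>2 + Q\<^sub>0 = s * (3 * s + r) / 4" "Q\<^sub>0 = (s - r) * (3 * s + 4 * r) / 4"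
      by (auto simp: Q\<^sub>0_def field_simps power2_eq_square)
    then have "B * (r\<^sup>2 + Q\<^sub>0) = B * (s * (3 * s + r) / 4)"
      and "Q\<^sub>0 * (s * (s - r) / 4) = (s - r)\<^sup>2 * (3 * s + 4 * r) * s / 16"
      by (simp_all add: power2_eq_square)
    moreover have "B * (s * (3 * s + r) / 4) = (s - r)\<^sup>2 * (3 * s + 4 * r) * s / 16"
      using r by (simp add: B_def divide_simps)
    ultimately show ?thesis unfolding D0 by (simp only:)
  qed
  have "J Q - J Q\<^sub>0 \<le> 16 / (s * (s - r))"
  proof (cases "Q = Q\<^sub>0")
    case True
    then show ?thesis using m by simp
  next
    case False
    then have "Q < Q\<^sub>0" using Q by simp
    then have "\<exists>\<xi>. Q < \<xi> \<and> \<xi> < Q\<^sub>0 \<and> J Q\<^sub>0 - J Q = (Q\<^sub>0 - Q) * (ln (r\<^sup>2 + \<xi>) - ln \<xi> - ln (d - \<xi>) + ln B)"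
    proof (rule MVT2)
      fix x assume "Q \<le> x" "x \<le> Q\<^sub>0"
      then have "x > 0" "d - x > 0" "r\<^sup>2 + x > 0" using \<open>2 < Q\<close> D0pos by (auto intro: add_nonneg_pos)
      then show "(J has_real_derivative ln (r\<^sup>2 + x) - ln x - ln (d - x) + ln B) (at x)"
        unfolding J_def by (auto intro!: derivative_eq_intros)
    qed
    then obtain \<xi> where \<xi>: "Q < \<xi>" "\<xi> < Q\<^sub>0" "J Q\<^sub>0 - J Q = (Q\<^sub>0 - Q) * (ln (r\<^sup>2 + \<xi>) - ln \<xi> - ln (d - \<xi>) + ln B)" by blast
    have pos: "\<xi> > 0" "d - \<xi> > 0" "r\<^sup>2 + \<xi> > 0" "d - Q\<^sub>0 + 2 > 0" using \<xi> \<open>2 < Q\<close> D0pos by (auto intro: add_nonneg_pos)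
    \<comment> \<open>The logarithm of the left side is minus the derivative of \<open>J\<close> at
      \<open>\<xi>\<close>. As \<open>x / (r\<^sup>2 + x)\<close> increases and
      \<open>d - \<xi>\<close> exceeds \<open>d - Q\<^sub>0\<close> by less than 2,
      \<open>Beq\<close> gives the bound.\<close>
    have "\<xi> * (d - \<xi>) / (B * (r\<^sup>2 + \<xi>)) \<le> (d - Q\<^sub>0 + 2) / (d - Q\<^sub>0)"
    proof -
      have "r\<^sup>2 * \<xi> \<le> r\<^sup>2 * Q\<^sub>0" using \<xi> by (intro mult_left_mono) auto
      then have "\<xi> * (r\<^sup>2 + Q\<^sub>0) \<le> Q\<^sub>0 * (r\<^sup>2 + \<xi>)" by (simp add: algebra_simps)
      then have "(\<xi> * (r\<^sup>2 + Q\<^sub>0)) * (d - \<xi>) \<le> (Q\<^sub>0 * (r\<^sup>2 + \<xi>)) * (d - Q\<^sub>0 + 2)"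
      proof (rule mult_mono)
        show "d - \<xi> \<le> d - Q\<^sub>0 + 2" using \<xi> Q by linarith
        show "0 \<le> Q\<^sub>0 * (r\<^sup>2 + \<xi>)" "0 \<le> d - \<xi>" using pos Q0 by simp_all
      qed
      then have "B * ((\<xi> * (r\<^sup>2 + Q\<^sub>0)) * (d - \<xi>)) \<le> B * ((Q\<^sub>0 * (r\<^sup>2 + \<xi>)) * (d - Q\<^sub>0 + 2))"
        using Bpos by (intro mult_left_mono) auto
      moreover have "B * ((\<xi> * (r\<^sup>2 + Q\<^sub>0)) * (d - \<xi>)) = Q\<^sub>0 * (d - Q\<^sub>0) * (\<xi> * (d - \<xi>))"
        unfolding Beq[symmetric] by (simp only: mult_ac)
      ultimately have "Q\<^sub>0 * (\<xi> * (d - \<xi>) * (d - Q\<^sub>0)) \<le> Q\<^sub>0 * ((d - Q\<^sub>0 + 2) * (B * (r\<^sup>2 + \<xi>)))"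
        by (simp only: mult_ac)
      then have "\<xi> * (d - \<xi>) * (d - Q\<^sub>0) \<le> (d - Q\<^sub>0 + 2) * (B * (r\<^sup>2 + \<xi>))"
        using Q0 by (subst (asm) mult_le_cancel_left_pos) auto
      then show ?thesis using Bpos pos D0pos by (simp add: divide_simps)
    qed
    then have "ln (\<xi> * (d - \<xi>) / (B * (r\<^sup>2 + \<xi>))) \<le> ln ((d - Q\<^sub>0 + 2) / (d - Q\<^sub>0))"
      using Bpos pos D0pos by (subst ln_le_cancel_iff) (auto intro!: divide_pos_pos mult_pos_pos)
    also have "\<dots> \<le> (d - Q\<^sub>0 + 2) / (d - Q\<^sub>0) - 1" using pos D0pos by (intro ln_le_minus_one) auto
    also have "\<dots> = 2 / (d - Q\<^sub>0)" using D0pos by (simp add: field_simps)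
    also have "\<dots> = 8 / (s * (s - r))" unfolding D0 by simp
    finally have "- (ln (r\<^sup>2 + \<xi>) - ln \<xi> - ln (d - \<xi>) + ln B) \<le> 8 / (s * (s - r))"
      using Bpos pos by (simp add: ln_div ln_mult)
    then have "(Q\<^sub>0 - Q) * (- (ln (r\<^sup>2 + \<xi>) - ln \<xi> - ln (d - \<xi>) + ln B)) \<le> (Q\<^sub>0 - Q) * (8 / (s * (s - r)))"
      using Q by (intro mult_left_mono) auto
    also have "\<dots> \<le> 2 * (8 / (s * (s - r)))" using Q m by (intro mult_right_mono) auto
    finally show ?thesis using \<xi>(3) by (simp add: algebra_simps)
  qed
  moreover have "16 / (s * (s - r)) \<le> 53/200 * (s * (s - r))"
  proof -
    have "((3349/1000) * (2349/1000)) * ((3349/1000) * (2349/1000)) \<le> (s * (s - r)) * (s * (s - r))"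
      by (rule mult_mono[OF m m]) (use m in auto)
    then have "16 \<le> 53/200 * (s * (s - r)) * (s * (s - r))" by simp
    then show ?thesis using m by (subst pos_divide_le_eq) auto
  qed
  moreover have "J Q\<^sub>0 \<le> - (s - r)\<^sup>2 / 4 - 53/200 * (s * (s - r))"
    using smallest_gain_exponent_at_optimum[of r s] r by (simp add: J_def B_def d_def Q\<^sub>0_def)
  ultimately have "J Q \<le> - (s - r)\<^sup>2 / 4" by simp
  then show "((r\<^sup>2 + Q) * ln (r\<^sup>2 + Q) - r\<^sup>2 * ln (r\<^sup>2) - Q) - (Q * ln Q - Q)
     - (d * ln d - (d - Q) * ln (d - Q) - Q) + Q * ln ((s - r)\<^sup>2 * (3 * s + 4 * r) / (4 * (3 * s + r)))
     \<le> - (s - r)\<^sup>2 / 4" by (simp add: J_def B_def)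
qed

section \<open>The standard Gaussian measure on a Euclidean space\<close>

text \<open>One constant for all Euclidean spaces, so that vectors, matrices and pairs share their
  lemmas. The product form serves integrals that factor over coordinates; the radial form behind
  isometry invariance is \<open>prod_std_normal_density\<close>.\<close>

definition gauss :: "'a::euclidean_space measure" where
  "gauss = density lborel (\<lambda>x. ennreal (\<Prod>b\<in>Basis. std_normal_density (x \<bullet> b)))"

lemma sets_gauss [measurable_cong, simp]: "sets gauss = sets borel"
  and space_gauss [simp]: "space gauss = UNIV"
  by (simp_all add: gauss_def)

lemma nn_integral_gauss_prod:
  fixes f :: "'a::euclidean_space \<Rightarrow> real \<Rightarrow> ennreal"
  assumes [measurable]: "\<And>b. b \<in> Basis \<Longrightarrow> f b \<in> borel_measurable borel"
  shows "(\<integral>\<^sup>+x. (\<Prod>b\<in>Basis. f b (x \<bullet> b)) \<partial>gauss) = (\<Prod>b\<in>Basis. \<integral>\<^sup>+t. f b t \<partial>density lborel std_normal_density)"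
proof -
  have "(\<integral>\<^sup>+x. (\<Prod>b\<in>Basis. f b (x \<bullet> b)) \<partial>gauss)
     = (\<integral>\<^sup>+x. (\<Prod>b\<in>Basis. ennreal (std_normal_density (x \<bullet> b)) * f b (x \<bullet> b)) \<partial>lborel)"
    unfolding gauss_def by (subst nn_integral_density) (auto simp: prod.distrib prod_ennreal)
  also have "\<dots> = (\<Prod>b\<in>Basis. \<integral>\<^sup>+t. ennreal (std_normal_density t) * f b t \<partial>lborel)"
    by (rule nn_integral_lborel_prod) auto
  also have "\<dots> = (\<Prod>b\<in>Basis. \<integral>\<^sup>+t. f b t \<partial>density lborel std_normal_density)"
    by (intro prod.cong refl, subst nn_integral_density) auto
  finally show ?thesis .
qed

lemma prob_space_std_normal: "prob_space (density lborel std_normal_density)"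
  by (rule prob_space_normal_density) simp

lemma prob_space_gauss: "prob_space (gauss :: 'a::euclidean_space measure)"
proof
  have "(\<integral>\<^sup>+x. (\<Prod>b\<in>(Basis :: 'a set). 1) \<partial>(gauss :: 'a measure)) = (\<Prod>b\<in>(Basis :: 'a set). \<integral>\<^sup>+t. 1 \<partial>density lborel std_normal_density)"
    by (rule nn_integral_gauss_prod[of "\<lambda>_ _. 1"]) auto
  also have "\<dots> = 1"
    using prob_space.emeasure_space_1[OF prob_space_std_normal] by simp
  finally show "emeasure gauss (space (gauss :: 'a measure)) = 1" by simp
qed

lemma prod_std_normal_density:
  fixes x :: "'a::euclidean_space"
  shows "(\<Prod>b\<in>Basis. std_normal_density (x \<bullet> b)) = (1 / sqrt (2 * pi)) ^ DIM('a) * exp (- (norm x)\<^sup>2 / 2)"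
proof -
  have "(norm x)\<^sup>2 = (\<Sum>b\<in>Basis. (x \<bullet> b)\<^sup>2)"
    by (subst power2_norm_eq_inner, subst euclidean_inner) (simp add: power2_eq_square)
  then show ?thesis
    by (simp add: std_normal_density_def prod.distrib prod_dividef exp_sum[symmetric] sum_negf sum_divide_distrib power_divide)
qed

section \<open>Invariance under linear isometries and product structure\<close>

lemma nn_integral_lborel_translate:
  fixes f :: "'a::euclidean_space \<Rightarrow> ennreal"
  assumes [measurable]: "f \<in> borel_measurable borel"
  shows "(\<integral>\<^sup>+x. f (c + x) \<partial>lborel) = (\<integral>\<^sup>+x. f x \<partial>lborel)" "(\<integral>\<^sup>+x. f (c - x) \<partial>lborel) = (\<integral>\<^sup>+x. f x \<partial>lborel)"
proof -
  show "(\<integral>\<^sup>+x. f (c + x) \<partial>lborel) = (\<integral>\<^sup>+x. f x \<partial>lborel)"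
    by (subst (2) lborel_affine[of 1 c]) (auto simp: nn_integral_density nn_integral_distr)
  show "(\<integral>\<^sup>+x. f (c - x) \<partial>lborel) = (\<integral>\<^sup>+x. f x \<partial>lborel)"
    by (subst (2) lborel_affine[of "-1" c]) (auto simp: nn_integral_density nn_integral_distr)
qed

lemma norm_preserving_linear_surj:
  fixes T :: "'a::euclidean_space \<Rightarrow> 'a"
  assumes "linear T" "\<And>x. norm (T x) = norm x"
  shows "surj T"
proof -
  have "inj T" using assms by (metis linear_injective_0 norm_eq_zero)
  then show ?thesis using assms linear_injective_imp_surjective by blast
qed

text \<open>The uniqueness argument for Haar measure: for a unit ball \<open>B\<close>, evaluate the double integral of
  \<open>indicator A (T x) * indicator B (y + T x)\<close> in both orders.\<close>
lemma distr_lborel_isometry: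
  fixes T :: "'a::euclidean_space \<Rightarrow> 'a"
  assumes T: "linear T" "\<And>x. norm (T x) = norm x"
  shows "distr lborel borel T = lborel"
proof (rule measure_eqI)
  fix A assume "A \<in> sets (distr lborel borel T)"
  then have A [measurable]: "A \<in> sets borel" by simp
  have [measurable]: "T \<in> borel \<rightarrow>\<^sub>M borel"
    using linear_continuous_on[of T UNIV] T(1) by (intro borel_measurable_continuous_onI) (simp add: linear_linear)
  define B where "B = ball (0::'a) 1"
  have B [measurable]: "B \<in> sets borel" by (simp add: B_def)
  have vB: "T -` B = B" by (auto simp: B_def T(2))
  let ?I = "indicator :: 'a set \<Rightarrow> 'a \<Rightarrow> ennreal"
  have indT: "(\<integral>\<^sup>+x. ?I S (T x) \<partial>lborel) = emeasure lborel (T -` S)" if [measurable]: "S \<in> sets borel" for S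
  proof -
    have "(\<integral>\<^sup>+x. ?I S (T x) \<partial>lborel) = (\<integral>\<^sup>+x. ?I (T -` S) x \<partial>lborel)" by (simp add: indicator_def)
    also have "\<dots> = emeasure lborel (T -` S)"
      using measurable_sets[of T borel borel S] that by (intro nn_integral_indicator) simp
    finally show ?thesis .
  qed
  have "emeasure lborel B * emeasure lborel (T -` A) = (\<integral>\<^sup>+x. ?I A (T x) * emeasure lborel B \<partial>lborel)"
    by (subst nn_integral_multc) (auto simp: indT mult.commute)
  also have "\<dots> = (\<integral>\<^sup>+x. \<integral>\<^sup>+y. ?I A (T x) * ?I B (T x + y) \<partial>lborel \<partial>lborel)"
    by (intro nn_integral_cong) (simp add: nn_integral_cmult nn_integral_lborel_translate)
  also have "\<dots> = (\<integral>\<^sup>+y. \<integral>\<^sup>+x. ?I A (T x) * ?I B (T x + y) \<partial>lborel \<partial>lborel)"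
    by (rule lborel_pair.Fubini') measurable
  also have "\<dots> = (\<integral>\<^sup>+y. \<integral>\<^sup>+x. ?I A (T x - y) * ?I B (T x) \<partial>lborel \<partial>lborel)"
  proof (rule nn_integral_cong)
    fix y
    \<comment> \<open>Surjectivity of \<open>T\<close> turns the shift by \<open>y\<close> after
      \<open>T\<close> into a translation before \<open>T\<close>.\<close>
    obtain z where z: "T z = y" using norm_preserving_linear_surj[OF T] by (metis surjD)
    have "(\<integral>\<^sup>+x. ?I A (T x) * ?I B (T x + y) \<partial>lborel) = (\<integral>\<^sup>+x. ?I A (T (- z + x)) * ?I B (T (- z + x) + y) \<partial>lborel)"
      by (rule nn_integral_lborel_translate(1)[symmetric]) measurable
    moreover have "T (- z + x) = T x - y" for x using T(1) z by (simp add: linear_diff)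
    ultimately show "(\<integral>\<^sup>+x. ?I A (T x) * ?I B (T x + y) \<partial>lborel) = (\<integral>\<^sup>+x. ?I A (T x - y) * ?I B (T x) \<partial>lborel)"
      by simp
  qed
  also have "\<dots> = (\<integral>\<^sup>+x. \<integral>\<^sup>+y. ?I A (T x - y) * ?I B (T x) \<partial>lborel \<partial>lborel)"
    by (rule lborel_pair.Fubini') measurable
  also have "\<dots> = (\<integral>\<^sup>+x. emeasure lborel A * ?I B (T x) \<partial>lborel)"
    by (intro nn_integral_cong) (simp add: nn_integral_multc nn_integral_lborel_translate)
  also have "\<dots> = emeasure lborel A * emeasure lborel B"
    by (subst nn_integral_cmult) (auto simp: indT vB)
  finally have "emeasure lborel B * emeasure lborel (T -` A) = emeasure lborel B * emeasure lborel A"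
    by (simp add: mult.commute)
  moreover have "emeasure lborel B \<noteq> \<infinity>" "emeasure lborel B \<noteq> 0"
    using emeasure_lborel_ball_finite[of "0::'a" 1] content_ball_pos[of 1 "0::'a"]
    by (auto simp: B_def measure_def)
  ultimately have "emeasure lborel (T -` A) = emeasure lborel A"
    by (simp add: ennreal_mult_cancel_left)
  then show "emeasure (distr lborel borel T) A = emeasure lborel A"
    by (simp add: emeasure_distr)
qed simp

lemma nn_integral_gauss_isometry:
  fixes T :: "'a::euclidean_space \<Rightarrow> 'a"
  assumes T: "linear T" "\<And>x. norm (T x) = norm x" and [measurable]: "f \<in> borel_measurable borel"
  shows "(\<integral>\<^sup>+x. f (T x) \<partial>gauss) = (\<integral>\<^sup>+x. f x \<partial>gauss)"
proof -
  define g where "g = (\<lambda>x::'a. ennreal ((1 / sqrt (2 * pi)) ^ DIM('a) * exp (- (norm x)\<^sup>2 / 2)))"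
  have [measurable]: "T \<in> borel \<rightarrow>\<^sub>M borel" "g \<in> borel_measurable borel"
    using linear_continuous_on[of T UNIV] T(1)
    by (auto intro!: borel_measurable_continuous_onI simp: linear_linear g_def)
  have gauss: "gauss = density lborel g" by (simp add: gauss_def prod_std_normal_density g_def)
  have "(\<integral>\<^sup>+x. f (T x) \<partial>gauss) = (\<integral>\<^sup>+x. g (T x) * f (T x) \<partial>lborel)"
    unfolding gauss by (subst nn_integral_density) (auto simp: g_def T(2))
  also have "\<dots> = (\<integral>\<^sup>+x. g x * f x \<partial>distr lborel borel T)"
    by (subst nn_integral_distr) auto
  also have "\<dots> = (\<integral>\<^sup>+x. f x \<partial>gauss)"
    unfolding distr_lborel_isometry[OF T] gauss by (subst nn_integral_density) auto
  finally show ?thesis .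
qed

text \<open>Squared norms add over the two components, so the radial densities multiply. This makes
  isometries that mix two independent Gaussian objects available.\<close>

lemma nn_integral_gauss_pair:
  fixes f :: "'a::euclidean_space \<times> 'b::euclidean_space \<Rightarrow> ennreal"
  assumes f: "f \<in> borel_measurable borel"
  shows "(\<integral>\<^sup>+x. \<integral>\<^sup>+y. f (x, y) \<partial>gauss \<partial>gauss) = (\<integral>\<^sup>+p. f p \<partial>gauss)"
proof -
  define g where "g = (\<lambda>x::'a. ennreal ((1 / sqrt (2 * pi)) ^ DIM('a) * exp (- (norm x)\<^sup>2 / 2)))"
  define h where "h = (\<lambda>x::'b. ennreal ((1 / sqrt (2 * pi)) ^ DIM('b) * exp (- (norm x)\<^sup>2 / 2)))"
  have [measurable]: "g \<in> borel_measurable borel" "h \<in> borel_measurable borel"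
    by (auto simp: g_def h_def)
  have [measurable]: "f \<in> borel_measurable (borel \<Otimes>\<^sub>M borel)" using f by (simp add: borel_prod)
  have gauss: "gauss = density lborel g" "gauss = density lborel h"
    "gauss = density lborel (\<lambda>p. g (fst p) * h (snd p))"
  proof -
    show "gauss = density lborel g" "gauss = density lborel h"
      by (simp_all add: gauss_def prod_std_normal_density g_def h_def)
    have "ennreal ((1 / sqrt (2 * pi)) ^ DIM('a \<times> 'b) * exp (- (norm p)\<^sup>2 / 2)) = g (fst p) * h (snd p)" for p :: "'a \<times> 'b"
    proof -
      have "exp (- (norm p)\<^sup>2 / 2) = exp (- (norm (fst p))\<^sup>2 / 2) * exp (- (norm (snd p))\<^sup>2 / 2)"
        by (subst mult_exp_exp) (simp add: norm_prod_def diff_divide_distrib)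
      then have "(1 / sqrt (2 * pi)) ^ DIM('a \<times> 'b) * exp (- (norm p)\<^sup>2 / 2)
         = ((1 / sqrt (2 * pi)) ^ DIM('a) * exp (- (norm (fst p))\<^sup>2 / 2)) * ((1 / sqrt (2 * pi)) ^ DIM('b) * exp (- (norm (snd p))\<^sup>2 / 2))"
        by (simp only: DIM_prod power_add mult_ac)
      then show ?thesis unfolding g_def h_def by (subst ennreal_mult[symmetric]) simp_all
    qed
    then show "gauss = density lborel (\<lambda>p :: 'a \<times> 'b. g (fst p) * h (snd p))"
      by (simp add: gauss_def prod_std_normal_density)
  qed
  have "(\<integral>\<^sup>+x. \<integral>\<^sup>+y. f (x, y) \<partial>gauss \<partial>gauss) = (\<integral>\<^sup>+x. \<integral>\<^sup>+y. g x * h y * f (x, y) \<partial>lborel \<partial>lborel)"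
    unfolding gauss(1,2) by (simp add: nn_integral_density nn_integral_cmult mult.assoc)
  also have "\<dots> = (\<integral>\<^sup>+p. g (fst p) * h (snd p) * f p \<partial>(lborel \<Otimes>\<^sub>M lborel))"
    by (subst lborel.nn_integral_fst[symmetric]) auto
  also have "\<dots> = (\<integral>\<^sup>+p. f p \<partial>gauss)"
    unfolding gauss(3) lborel_prod by (subst nn_integral_density) (use f in \<open>auto simp: borel_prod[symmetric]\<close>)
  finally show ?thesis .
qed

text \<open>The tilted density is, up to the factor \<open>\<sigma>\<close>, the normal density of
  variance \<open>1 / (1 - 2 * \<theta>)\<close>.\<close>

lemma nn_integral_exp_square_std_normal:
  assumes "\<theta> < 1 / 2"
  shows "(\<integral>\<^sup>+t. ennreal (exp (\<theta> * t\<^sup>2)) \<partial>density lborel std_normal_density) = ennreal ((1 - 2 * \<theta>) powr (- (1 / 2)))"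
proof -
  define \<sigma> where "\<sigma> = 1 / sqrt (1 - 2 * \<theta>)"
  have \<sigma>: "\<sigma> > 0" using assms by (simp add: \<sigma>_def)
  have \<sigma>2: "\<sigma>\<^sup>2 = 1 / (1 - 2 * \<theta>)"
    using assms by (simp add: \<sigma>_def power_divide)
  have eq: "std_normal_density t * exp (\<theta> * t\<^sup>2) = \<sigma> * normal_density 0 \<sigma> t" for t
  proof -
    have 1: "sqrt (2 * pi * \<sigma>\<^sup>2) = sqrt (2 * pi) * \<sigma>" using \<sigma> by (simp add: real_sqrt_mult)
    have "- t\<^sup>2 / (2 * (1 / u)) = - t\<^sup>2 / 2 + (1 - u) / 2 * t\<^sup>2" for u :: real
      by (simp add: algebra_simps diff_divide_distrib)
    from this[of "1 - 2 * \<theta>"] have "- t\<^sup>2 / (2 * \<sigma>\<^sup>2) = - t\<^sup>2 / 2 + \<theta> * t\<^sup>2"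
      unfolding \<sigma>2 by simp
    then have 2: "exp (- t\<^sup>2 / (2 * \<sigma>\<^sup>2)) = exp (- t\<^sup>2 / 2) * exp (\<theta> * t\<^sup>2)"
      by (simp only: exp_add)
    show ?thesis
      unfolding normal_density_def std_normal_density_def diff_0_right 1 2 using \<sigma> by simp
  qed
  have "(\<integral>\<^sup>+t. ennreal (normal_density 0 \<sigma> t) \<partial>lborel) = 1"
    using prob_space.emeasure_space_1[OF prob_space_normal_density[OF \<sigma>, of 0]] by (simp add: emeasure_density)
  then have "(\<integral>\<^sup>+t. ennreal \<sigma> * ennreal (normal_density 0 \<sigma> t) \<partial>lborel) = ennreal \<sigma>"
    by (subst nn_integral_cmult) auto
  moreover have "(\<integral>\<^sup>+t. ennreal (exp (\<theta> * t\<^sup>2)) \<partial>density lborel std_normal_density) = (\<integral>\<^sup>+t. ennreal \<sigma> * ennreal (normal_density 0 \<sigma> t) \<partial>lborel)"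
    by (subst nn_integral_density) (simp_all add: ennreal_mult[symmetric] less_imp_le[OF \<sigma>] eq)
  moreover have "(1 - 2 * \<theta>) powr (- (1 / 2)) = \<sigma>"
  proof -
    have "(1 - 2 * \<theta>) powr (1 / 2) = sqrt (1 - 2 * \<theta>)" by (rule powr_half_sqrt) (use assms in simp)
    then show ?thesis by (simp only: powr_minus \<sigma>_def inverse_eq_divide)
  qed
  ultimately show ?thesis by (simp only:)
qed

text \<open>A subset \<open>S\<close> is allowed because of two uses: all coordinates with positive
  \<open>\<theta>\<close> for moments of the norm, and the coordinates orthogonal to a subspace with
  negative \<open>\<theta>\<close> for the distance to it.\<close>

lemma nn_integral_exp_square_gauss:
  fixes S :: "'a::euclidean_space set"
  assumes "\<theta> < 1 / 2" "S \<subseteq> Basis"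
  shows "(\<integral>\<^sup>+x. ennreal (exp (\<theta> * (\<Sum>b\<in>S. (x \<bullet> b)\<^sup>2))) \<partial>(gauss :: 'a measure)) = ennreal ((1 - 2 * \<theta>) powr (- (real (card S) / 2)))"
proof -
  have fin: "finite S" by (rule finite_subset[OF assms(2) finite_Basis])
  define f where "f = (\<lambda>b t. if b \<in> S then ennreal (exp (\<theta> * t\<^sup>2)) else 1)"
  have "ennreal (exp (\<theta> * (\<Sum>b\<in>S. (x \<bullet> b)\<^sup>2))) = (\<Prod>b\<in>Basis. f b (x \<bullet> b))" for x
  proof -
    have "(\<Prod>b\<in>Basis. f b (x \<bullet> b)) = (\<Prod>b\<in>S. ennreal (exp (\<theta> * (x \<bullet> b)\<^sup>2)))"
      using assms(2) by (intro prod.mono_neutral_cong_right) (auto simp: f_def)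
    also have "\<dots> = ennreal (exp (\<theta> * (\<Sum>b\<in>S. (x \<bullet> b)\<^sup>2)))"
      by (simp add: prod_ennreal exp_sum[OF fin, symmetric] sum_distrib_left)
    finally show ?thesis by simp
  qed
  then have "(\<integral>\<^sup>+x. ennreal (exp (\<theta> * (\<Sum>b\<in>S. (x \<bullet> b)\<^sup>2))) \<partial>gauss) = (\<Prod>b\<in>Basis. \<integral>\<^sup>+t. f b t \<partial>density lborel std_normal_density)"
    by (simp only:) (rule nn_integral_gauss_prod, simp add: f_def)
  also have "\<dots> = (\<Prod>b\<in>S. \<integral>\<^sup>+t. ennreal (exp (\<theta> * t\<^sup>2)) \<partial>density lborel std_normal_density)"
    using assms(2) prob_space.emeasure_space_1[OF prob_space_std_normal]
    by (intro prod.mono_neutral_cong_right) (auto simp: f_def)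
  also have "\<dots> = ennreal (\<Prod>b\<in>S. (1 - 2 * \<theta>) powr (- (1 / 2)))"
    by (simp add: nn_integral_exp_square_std_normal[OF assms(1)] ennreal_power)
  also have "(\<Prod>b\<in>S. (1 - 2 * \<theta>) powr (- (1 / 2))) = (1 - 2 * \<theta>) powr (- (real (card S) / 2))"
    using powr_power[of "1 - 2 * \<theta>" "- (1 / 2)" "card S"] assms(1) by simp
  finally show ?thesis .
qed

text \<open>With \<open>y = (norm x)\<^sup>2\<close>, the inequality
  \<open>1 + u \<le> exp u\<close> gives
  \<open>y ^ p \<le> (p / \<theta>) ^ p * exp (\<theta> * y - p)\<close>. The choice
  \<open>\<theta> = p / (N + 2 * p)\<close> minimises the integral of the right side and yields the
  same \<open>x * ln x\<close> shape as the other estimates that enter the exponents.\<close>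

lemma nn_integral_even_moment_gauss_le:
  "(\<integral>\<^sup>+x. ennreal (norm x ^ (2 * p)) \<partial>(gauss :: 'a::euclidean_space measure))
    \<le> ennreal (exp (((DIM('a) + 2 * real p) * ln (DIM('a) + 2 * real p) - DIM('a) * ln DIM('a) - 2 * real p) / 2))"
proof (cases "p = 0")
  case True
  then show ?thesis
    using prob_space.emeasure_space_1[OF prob_space_gauss[where 'a = 'a]] by simp
next
  case False
  define N where "N = real DIM('a)"
  define \<theta> where "\<theta> = real p / (N + 2 * real p)"
  have N: "N > 0" by (simp add: N_def)
  have p: "real p > 0" using False by simp
  have \<theta>: "\<theta> > 0" "\<theta> < 1 / 2" using N p by (auto simp: \<theta>_def field_simps)
  have "(\<integral>\<^sup>+x. ennreal (norm x ^ (2 * p)) \<partial>(gauss :: 'a measure)) \<le> (\<integral>\<^sup>+x. ennreal ((real p / \<theta>) ^ p * exp (- real p)) * ennreal (exp (\<theta> * (\<Sum>b\<in>Basis. (x \<bullet> b)\<^sup>2))) \<partial>(gauss :: 'a measure))"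
  proof (rule nn_integral_mono)
    fix x :: 'a
    define y where "y = (norm x)\<^sup>2"
    have y: "y = (\<Sum>b\<in>Basis. (x \<bullet> b)\<^sup>2)" "y \<ge> 0"
      unfolding y_def by (subst power2_norm_eq_inner, subst euclidean_inner) (auto simp: power2_eq_square)
    have "\<theta> * y / p \<le> exp (\<theta> * y / p - 1)" using exp_ge_add_one_self[of "\<theta> * y / p - 1"] by simp
    then have "(\<theta> * y / p) ^ p \<le> exp (\<theta> * y / p - 1) ^ p" using y \<theta> by (intro power_mono) auto
    also have "\<dots> = exp (\<theta> * y) * exp (- real p)"
      using p by (simp add: exp_of_nat_mult[symmetric] exp_add[symmetric] algebra_simps)
    finally have "(real p / \<theta>) ^ p * (\<theta> * y / p) ^ p \<le> (real p / \<theta>) ^ p * (exp (\<theta> * y) * exp (- real p))"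
      using \<theta> by (intro mult_left_mono) auto
    also have "(real p / \<theta>) ^ p * (\<theta> * y / p) ^ p = y ^ p"
      using p \<theta> by (simp add: power_mult_distrib[symmetric])
    finally have "norm x ^ (2 * p) \<le> (real p / \<theta>) ^ p * exp (- real p) * exp (\<theta> * (\<Sum>b\<in>Basis. (x \<bullet> b)\<^sup>2))"
      unfolding y(1)[symmetric] y_def power_mult[symmetric] by (simp only: mult_ac)
    then show "ennreal (norm x ^ (2 * p)) \<le> ennreal ((real p / \<theta>) ^ p * exp (- real p)) * ennreal (exp (\<theta> * (\<Sum>b\<in>Basis. (x \<bullet> b)\<^sup>2)))"
      using \<theta> by (simp add: ennreal_mult[symmetric])
  qed
  also have "\<dots> = ennreal ((real p / \<theta>) ^ p * exp (- real p)) * (\<integral>\<^sup>+x. ennreal (exp (\<theta> * (\<Sum>b\<in>Basis. (x \<bullet> b)\<^sup>2))) \<partial>(gauss :: 'a measure))"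
    by (rule nn_integral_cmult) simp
  also have "(\<integral>\<^sup>+x. ennreal (exp (\<theta> * (\<Sum>b\<in>Basis. (x \<bullet> b)\<^sup>2))) \<partial>(gauss :: 'a measure)) = ennreal ((1 - 2 * \<theta>) powr (- (N / 2)))"
    unfolding N_def using nn_integral_exp_square_gauss[OF \<theta>(2), of "Basis :: 'a set"] by auto
  also have "ennreal ((real p / \<theta>) ^ p * exp (- real p)) * \<dots> = ennreal (exp (((N + 2 * real p) * ln (N + 2 * real p) - N * ln N - 2 * real p) / 2))"
  proof -
    have "(real p / \<theta>) ^ p = exp (real p * ln (N + 2 * real p))"
    proof -
      have "real p / \<theta> = N + 2 * real p" using p N by (simp add: \<theta>_def)
      then show ?thesis using p N by (simp add: exp_of_nat_mult)
    qed
    moreover have "(1 - 2 * \<theta>) powr (- (N / 2)) = exp (N / 2 * (ln (N + 2 * real p) - ln N))"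
    proof -
      have e: "1 - 2 * \<theta> = N / (N + 2 * real p)" using p N by (simp add: \<theta>_def field_simps)
      have "ln (1 - 2 * \<theta>) = ln N - ln (N + 2 * real p)" unfolding e ln_div using p N by auto
      then have "- (N / 2) * ln (1 - 2 * \<theta>) = N / 2 * (ln (N + 2 * real p) - ln N)"
        by (simp only: right_diff_distrib mult_minus_left)
      moreover have "1 - 2 * \<theta> \<noteq> 0" using \<theta> by simp
      ultimately show ?thesis unfolding powr_def by (simp only: if_False)
    qed
    ultimately show ?thesis
      by (simp add: ennreal_mult[symmetric] exp_add[symmetric] field_simps)
  qed
  finally show ?thesis by (simp add: N_def)
qed

section \<open>Coordinates adapted to a subspace or a direction\<close>

lemma orthonormal_expansion:
  fixes B :: "'a::euclidean_space set"
  assumes "pairwise orthogonal B" "\<And>b. b \<in> B \<Longrightarrow> norm b = 1" "x \<in> span B" "finite B"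
  shows "x = (\<Sum>b\<in>B. (x \<bullet> b) *\<^sub>R b)"
proof -
  define u where "u = x - (\<Sum>b\<in>B. (x \<bullet> b) *\<^sub>R b)"
  have "orthogonal u b" if "b \<in> B" for b
  proof -
    have "(\<Sum>c\<in>B. (x \<bullet> c) *\<^sub>R c) \<bullet> b = (\<Sum>c\<in>B. if c = b then x \<bullet> b else 0)"
      unfolding inner_sum_left using assms(1,2) that
      by (intro sum.cong) (auto simp: pairwise_def orthogonal_def norm_eq_1)
    also have "\<dots> = x \<bullet> b" using that assms(4) by simp
    finally show ?thesis by (simp add: u_def orthogonal_def inner_diff_left)
  qed
  moreover have "u \<in> span B"
    unfolding u_def using assms(3) by (auto intro!: span_diff span_sum span_scale intro: span_base)
  ultimately have "orthogonal u u" using orthogonal_to_span by blast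
  then show ?thesis by (simp add: u_def orthogonal_def)
qed

text \<open>An orthonormal basis of \<open>H\<close> together with one of its orthogonal complement
  is mapped bijectively onto the standard basis; \<open>S\<close> is the image of the second
  part.\<close>

lemma isometry_onto_coordinates:
  fixes H :: "'a::euclidean_space set"
  assumes H: "subspace H"
  obtains T :: "'a \<Rightarrow> 'a" and S where "linear T" "\<And>x. norm (T x) = norm x" "S \<subseteq> Basis"
    "card S = DIM('a) - dim H" "\<And>x b. x \<in> H \<Longrightarrow> b \<in> S \<Longrightarrow> T x \<bullet> b = 0"
proof -
  obtain B1 where B1: "B1 \<subseteq> H" "pairwise orthogonal B1" "\<And>x. x \<in> B1 \<Longrightarrow> norm x = 1" "independent B1" "card B1 = dim H" "span B1 = H"
    using orthonormal_basis_subspace[OF H] by metis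
  define K where "K = {y. \<forall>x\<in>H. orthogonal x y}"
  have K: "subspace K" unfolding K_def by (rule subspace_orthogonal_to_vectors)
  have dK: "dim K + dim H = DIM('a)"
    using dim_subspace_orthogonal_to_vectors[OF H subspace_UNIV] by (simp add: K_def)
  obtain B2 where B2: "B2 \<subseteq> K" "pairwise orthogonal B2" "\<And>x. x \<in> B2 \<Longrightarrow> norm x = 1" "independent B2" "card B2 = dim K" "span B2 = K"
    using orthonormal_basis_subspace[OF K] by metis
  define B where "B = B1 \<union> B2"
  have fin: "finite B1" "finite B2" "finite B" using B1(4) B2(4) by (auto simp: independent_imp_finite B_def)
  have orth12: "orthogonal x y" if "x \<in> H" "y \<in> B2" for x y using that B2(1) by (auto simp: K_def)
  have orth: "pairwise orthogonal B"
    unfolding B_def pairwise_def using B1(1,2) B2(2) orth12 by (metis Un_iff orthogonal_commute pairwise_def subsetD)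
  have nrm: "norm b = 1" if "b \<in> B" for b using that B1(3) B2(3) by (auto simp: B_def)
  have disj: "B1 \<inter> B2 = {}" using B1(1,3) orth12 by (force simp: orthogonal_def norm_eq_1)
  have card: "card B = DIM('a)" using disj fin dK B1(5) B2(5) by (simp add: B_def card_Un_disjoint)
  have "independent B" using orth nrm by (intro pairwise_orthogonal_independent) (auto dest: nrm)
  then have span: "span B = UNIV" using card fin by (metis dim_eq_card_independent dim_eq_full)
  obtain \<phi> where \<phi>: "bij_betw \<phi> B (Basis :: 'a set)"
    using card fin finite_Basis by (metis finite_same_card_bij)
  define T where "T = (\<lambda>x. \<Sum>b\<in>B. (x \<bullet> b) *\<^sub>R \<phi> b)"
  have T\<phi>: "T x \<bullet> \<phi> b = x \<bullet> b" if "b \<in> B" for x b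
  proof -
    have "T x \<bullet> \<phi> b = (\<Sum>c\<in>B. if c = b then x \<bullet> b else 0)"
      unfolding T_def inner_sum_left
    proof (intro sum.cong refl)
      fix c assume "c \<in> B"
      then have "\<phi> c \<in> Basis" "\<phi> b \<in> Basis" "\<phi> c = \<phi> b \<longleftrightarrow> c = b"
        using \<phi> that by (auto simp: bij_betw_def inj_on_def)
      then show "(x \<bullet> c) *\<^sub>R \<phi> c \<bullet> \<phi> b = (if c = b then x \<bullet> b else 0)"
        by (auto simp: inner_Basis)
    qed
    then show ?thesis using that fin by simp
  qed
  show thesis
  proof
    show "linear T" unfolding T_def
      by (intro linear_compose_sum ballI linearI) (auto simp: inner_add_left scaleR_add_left)
    show "norm (T x) = norm x" for x
    proof -
      have "T x \<bullet> T x = (\<Sum>b\<in>Basis. (T x \<bullet> b) * (T x \<bullet> b))" by (rule euclidean_inner)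
      also have "\<dots> = (\<Sum>b\<in>B. (x \<bullet> b) * (x \<bullet> b))"
        by (subst sum.reindex_bij_betw[OF \<phi>, symmetric]) (auto simp: T\<phi>)
      also have "\<dots> = (\<Sum>b\<in>B. (x \<bullet> b) *\<^sub>R b) \<bullet> x" by (simp add: inner_sum_left inner_sum_right inner_commute)
      also have "\<dots> = x \<bullet> x" using orthonormal_expansion[OF orth nrm _ fin(3), of x] span by simp
      finally show ?thesis by (simp add: norm_eq)
    qed
    show "\<phi> ` B2 \<subseteq> Basis" using \<phi> by (auto simp: bij_betw_def B_def)
    show "card (\<phi> ` B2) = DIM('a) - dim H"
      using \<phi> dK B2(5) by (subst card_image) (auto simp: bij_betw_def B_def inj_on_def)
    show "T x \<bullet> b = 0" if "x \<in> H" "b \<in> \<phi> ` B2" for x b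
      using that orth12 T\<phi> by (auto simp: B_def orthogonal_def)
  qed
qed

lemma nn_integral_even_moment_inner_gauss:
  fixes q :: "'a::euclidean_space"
  shows "(\<integral>\<^sup>+x. ennreal ((q \<bullet> x) ^ (2 * p)) \<partial>gauss) = ennreal (norm q ^ (2 * p) * (fact (2 * p) / (2 ^ p * fact p)))"
proof -
  obtain c :: 'a where c: "c \<in> Basis" using nonempty_Basis by blast
  obtain T :: "'a \<Rightarrow> 'a" where T: "linear T" "\<And>x. norm (T x) = norm x" "T (norm q *\<^sub>R c) = q"
  proof
    \<comment> \<open>The Householder reflection that exchanges \<open>norm q *\<^sub>R c\<close>
      and \<open>q\<close>. If the two coincide, then \<open>v = 0\<close> and division by zero
      makes \<open>R\<close> the identity.\<close>
    define v where "v = norm q *\<^sub>R c - q"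
    define R where "R = (\<lambda>x. x - (2 * (x \<bullet> v) / (v \<bullet> v)) *\<^sub>R v)"
    show "linear R" unfolding R_def
      by (rule linearI) (auto simp: inner_add_left algebra_simps add_divide_distrib)
    show "norm (R x) = norm x" for x
      by (cases "v = 0") (auto simp: R_def norm_eq inner_diff_left inner_diff_right inner_commute field_simps)
    have "2 * ((norm q *\<^sub>R c) \<bullet> v) = v \<bullet> v"
    proof -
      have "c \<bullet> c = 1" "q \<bullet> q = norm q * norm q" using c by (simp_all add: dot_square_norm power2_eq_square)
      then show ?thesis
        by (simp add: v_def inner_diff_left inner_diff_right inner_commute[of c q] algebra_simps)
    qed
    then show "R (norm q *\<^sub>R c) = q"
      by (cases "v = 0") (auto simp: R_def v_def)
  qed
  have inner: "T x \<bullet> T y = x \<bullet> y" for x y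
    using T(1,2) by (simp add: dot_norm linear_add[symmetric])
  have "(\<integral>\<^sup>+x. ennreal ((q \<bullet> x) ^ (2 * p)) \<partial>gauss) = (\<integral>\<^sup>+x. ennreal ((q \<bullet> T x) ^ (2 * p)) \<partial>gauss)"
    by (rule nn_integral_gauss_isometry[OF T(1,2), symmetric]) simp
  also have "\<dots> = (\<integral>\<^sup>+x. ennreal ((norm q * (c \<bullet> x)) ^ (2 * p)) \<partial>gauss)"
    by (subst T(3)[symmetric], subst inner) simp
  also have "\<dots> = (\<integral>\<^sup>+x. ennreal (norm q ^ (2 * p)) * (\<Prod>b\<in>Basis. if b = c then ennreal ((x \<bullet> b) ^ (2 * p)) else 1) \<partial>gauss)"
    using c by (intro nn_integral_cong) (simp add: ennreal_mult[symmetric] power_mult_distrib inner_commute)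
  also have "\<dots> = ennreal (norm q ^ (2 * p)) * (\<integral>\<^sup>+x. (\<Prod>b\<in>Basis. if b = c then ennreal ((x \<bullet> b) ^ (2 * p)) else 1) \<partial>gauss)"
    by (rule nn_integral_cmult) simp
  also have "(\<integral>\<^sup>+x. (\<Prod>b\<in>Basis. if b = c then ennreal ((x \<bullet> b) ^ (2 * p)) else 1) \<partial>gauss) =
     (\<Prod>b\<in>Basis. \<integral>\<^sup>+t. (if b = c then ennreal (t ^ (2 * p)) else 1) \<partial>density lborel std_normal_density)"
    by (rule nn_integral_gauss_prod) simp
  also have "\<dots> = (\<Prod>b\<in>Basis. if b = c then (\<integral>\<^sup>+t. ennreal (t ^ (2 * p)) \<partial>density lborel std_normal_density) else 1)"
    using prob_space.emeasure_space_1[OF prob_space_std_normal] by (intro prod.cong) auto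
  also have "\<dots> = (\<integral>\<^sup>+t. ennreal (t ^ (2 * p)) \<partial>density lborel std_normal_density)" using c by simp
  also have "\<dots> = (\<integral>\<^sup>+t. ennreal (std_normal_density t * t ^ (2 * p)) \<partial>lborel)"
    by (subst nn_integral_density) (auto simp: ennreal_mult[symmetric])
  also have "\<dots> = ennreal (fact (2 * p) / (2 ^ p * fact p))"
    using std_normal_moment_even[of p]
    by (subst nn_integral_eq_integral) (auto simp: has_bochner_integral_iff)
  finally show ?thesis by (simp only: ennreal_mult[symmetric] zero_le_power norm_ge_zero divide_nonneg_nonneg
      fact_ge_zero mult_nonneg_nonneg zero_le_numeral)
qed

section \<open>Negative moments of the distance to a subspace\<close>

text \<open>For \<open>x > 0\<close> this is \<open>1 / x ^ Suc k\<close>. Written as a mixture of exponentials, its expectation only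
  requires the Laplace transform of a squared Gaussian norm.\<close>
definition laplace_kernel :: "nat \<Rightarrow> real \<Rightarrow> ennreal" where
  "laplace_kernel k x = (\<integral>\<^sup>+\<theta>. ennreal (\<theta> ^ k / fact k * exp (- \<theta> * x)) * indicator {0..} \<theta> \<partial>lborel)"

lemma laplace_kernel_measurable [measurable]: "laplace_kernel k \<in> borel_measurable borel"
  unfolding laplace_kernel_def by measurable

text \<open>No positivity is assumed: for arguments at most 0 the integral diverges, so a vanishing
  distance gets the value \<infinity> without a separate case.\<close>

lemma laplace_kernel_antimono: "x \<le> y \<Longrightarrow> laplace_kernel k y \<le> laplace_kernel k x"
  unfolding laplace_kernel_def
  by (intro nn_integral_mono) (auto intro!: ennreal_leI divide_right_mono mult_left_mono split: split_indicator)

lemma laplace_kernel_eq: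
  assumes "x > 0"
  shows "laplace_kernel k x = ennreal (1 / x ^ Suc k)"
proof -
  have eq: "ennreal (\<theta> ^ k / fact k * exp (- \<theta> * x)) * indicator {0..} \<theta>
     = ennreal (1 / x ^ Suc k) * ennreal (erlang_density k x \<theta>)" for \<theta>
    using assms by (auto simp: erlang_density_def ennreal_mult[symmetric] mult_ac split: split_indicator)
  have "laplace_kernel k x = ennreal (1 / x ^ Suc k) * (\<integral>\<^sup>+\<theta>. ennreal (erlang_density k x \<theta>) \<partial>lborel)"
    unfolding laplace_kernel_def eq by (rule nn_integral_cmult) simp
  also have "(\<integral>\<^sup>+\<theta>. ennreal (erlang_density k x \<theta>) \<partial>lborel) = 1"
    using prob_space.emeasure_space_1[OF prob_space_erlang_density[OF assms, of k]] by (simp add: emeasure_density)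
  finally show ?thesis by simp
qed

text \<open>Integration by parts on the level of primitives: differentiating the power of
  \<open>\<theta>\<close> and integrating that of \<open>1 + 2 * \<theta>\<close> lowers
  \<open>k\<close> and \<open>\<mu>\<close> by 1 each. The condition on \<open>\<mu>\<close> makes
  the boundary term at infinity vanish.\<close>

lemma beta_antiderivative:
  fixes \<mu> :: real
  assumes "\<mu> > real k + 1"
  shows "\<exists>F. (\<forall>\<theta>\<ge>0. (F has_real_derivative \<theta> ^ k / fact k * (1 + 2 * \<theta>) powr (- \<mu>)) (at \<theta>))
     \<and> F 0 = - (1 / (\<Prod>j=1..Suc k. 2 * \<mu> - 2 * real j)) \<and> (F \<longlongrightarrow> 0) at_top"
  using assms
proof (induction k arbitrary: \<mu>)
  case 0
  let ?F = "\<lambda>\<theta>. - ((1 + 2 * \<theta>) powr (1 - \<mu>)) / (2 * \<mu> - 2)"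
  have "(?F has_real_derivative \<theta> ^ 0 / fact 0 * (1 + 2 * \<theta>) powr (- \<mu>)) (at \<theta>)" if "\<theta> \<ge> 0" for \<theta>
  proof -
    have "(?F has_real_derivative - ((1 - \<mu>) * (1 + 2 * \<theta>) powr (- \<mu>) * 2) / (2 * \<mu> - 2)) (at \<theta>)"
      using that 0 by (auto intro!: derivative_eq_intros)
    moreover have "- ((1 - \<mu>) * b * 2) / (2 * \<mu> - 2) = b" for b :: real using 0 by (simp add: field_simps)
    ultimately show ?thesis by simp
  qed
  moreover have "(?F \<longlongrightarrow> 0) at_top"
  proof -
    have "((\<lambda>\<theta>. (1 + 2 * \<theta>) powr (1 - \<mu>)) \<longlongrightarrow> 0) at_top"
      using 0 by (intro tendsto_neg_powr filterlim_tendsto_add_at_top[OF tendsto_const]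
          filterlim_tendsto_pos_mult_at_top[OF tendsto_const] filterlim_ident) auto
    then show ?thesis using tendsto_divide[OF tendsto_minus[of _ 0] tendsto_const, of "\<lambda>\<theta>. (1 + 2 * \<theta>) powr (1 - \<mu>)" at_top "2 * \<mu> - 2"] 0
      by simp
  qed
  ultimately show ?case by (intro exI[of _ ?F]) auto
next
  case (Suc k)
  have "real k + 1 < \<mu> - 1" using Suc.prems by simp
  from Suc.IH[OF this] obtain F where F: "\<And>\<theta>. \<theta> \<ge> 0 \<Longrightarrow> (F has_real_derivative \<theta> ^ k / fact k * (1 + 2 * \<theta>) powr (- (\<mu> - 1))) (at \<theta>)"
     "F 0 = - (1 / (\<Prod>j=1..Suc k. 2 * (\<mu> - 1) - 2 * real j))" "(F \<longlongrightarrow> 0) at_top"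
    by blast
  let ?G = "\<lambda>\<theta>. (F \<theta> - \<theta> ^ Suc k / fact (Suc k) * (1 + 2 * \<theta>) powr (1 - \<mu>)) / (2 * \<mu> - 2)"
  have "(?G has_real_derivative \<theta> ^ Suc k / fact (Suc k) * (1 + 2 * \<theta>) powr (- \<mu>)) (at \<theta>)" if "\<theta> \<ge> 0" for \<theta>
  proof -
    have "(?G has_real_derivative (\<theta> ^ k / fact k * (1 + 2 * \<theta>) powr (- (\<mu> - 1))
        - (real (Suc k) * \<theta> ^ k / fact (Suc k) * (1 + 2 * \<theta>) powr (1 - \<mu>)
          + \<theta> ^ Suc k / fact (Suc k) * ((1 - \<mu>) * (1 + 2 * \<theta>) powr (- \<mu>) * 2))) / (2 * \<mu> - 2)) (at \<theta>)"
      using that Suc.prems by (auto intro!: derivative_eq_intros F(1) simp del: fact_Suc power_Suc simp: divide_simps)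
    moreover have "real (Suc k) * \<theta> ^ k / fact (Suc k) = \<theta> ^ k / fact k" by (simp add: divide_simps)
    moreover have "- (\<mu> - 1) = 1 - \<mu>" by simp
    moreover have "(x - (x + a * ((1 - \<mu>) * b * 2))) / (2 * \<mu> - 2) = a * b" for x a b :: real
      using Suc.prems by (simp add: field_simps)
    ultimately show ?thesis by (simp only:)
  qed
  moreover have "(?G \<longlongrightarrow> 0) at_top"
  proof -
    have "((\<lambda>\<theta>. \<theta> ^ Suc k * (1 + 2 * \<theta>) powr (1 - \<mu>)) \<longlongrightarrow> 0) at_top"
    proof (rule tendsto_sandwich[of "\<lambda>_. 0" _ _ "\<lambda>\<theta>. (1 + 2 * \<theta>) powr (real (Suc k) + 1 - \<mu>)"])
      show "\<forall>\<^sub>F \<theta> in at_top. \<theta> ^ Suc k * (1 + 2 * \<theta>) powr (1 - \<mu>) \<le> (1 + 2 * \<theta>) powr (real (Suc k) + 1 - \<mu>)"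
        using eventually_ge_at_top[of 0]
      proof eventually_elim
        case (elim \<theta>)
        then have "\<theta> ^ Suc k \<le> (1 + 2 * \<theta>) ^ Suc k" by (intro power_mono) auto
        also have "\<dots> = (1 + 2 * \<theta>) powr real (Suc k)" using elim by (intro powr_realpow[symmetric]) auto
        finally have "\<theta> ^ Suc k * (1 + 2 * \<theta>) powr (1 - \<mu>) \<le> (1 + 2 * \<theta>) powr real (Suc k) * (1 + 2 * \<theta>) powr (1 - \<mu>)"
          by (intro mult_right_mono) auto
        then show ?case by (simp add: powr_add[symmetric] algebra_simps)
      qed
      show "\<forall>\<^sub>F \<theta> in at_top. 0 \<le> \<theta> ^ Suc k * (1 + 2 * \<theta>) powr (1 - \<mu>)"
        using eventually_ge_at_top[of "0::real"] by eventually_elim simp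
      show "((\<lambda>\<theta>. (1 + 2 * \<theta>) powr (real (Suc k) + 1 - \<mu>)) \<longlongrightarrow> 0) at_top"
        using Suc.prems by (intro tendsto_neg_powr filterlim_tendsto_add_at_top[OF tendsto_const]
          filterlim_tendsto_pos_mult_at_top[OF tendsto_const] filterlim_ident) auto
    qed simp
    then have "((\<lambda>\<theta>. (F \<theta> - (\<theta> ^ Suc k * (1 + 2 * \<theta>) powr (1 - \<mu>)) / fact (Suc k)) / (2 * \<mu> - 2)) \<longlongrightarrow> (0 - 0 / fact (Suc k)) / (2 * \<mu> - 2)) at_top"
      using Suc.prems by (intro tendsto_intros F(3)) auto
    then show ?thesis by (simp del: fact_Suc power_Suc)
  qed
  moreover have "?G 0 = - (1 / (\<Prod>j=1..Suc (Suc k). 2 * \<mu> - 2 * real j))"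
  proof -
    have "(\<Prod>j=1..Suc (Suc k). 2 * \<mu> - 2 * real j) = (2 * \<mu> - 2) * (\<Prod>j=1..Suc k. 2 * (\<mu> - 1) - 2 * real j)"
      by (subst prod.atLeast_Suc_atMost) (simp_all add: prod.atLeast_Suc_atMost_Suc_shift algebra_simps del: prod.cl_ivl_Suc)
    then show ?thesis by (simp add: F(2))
  qed
  ultimately show ?case by blast
qed

text \<open>\<open>(1 + 2 * \<theta>) powr (- \<mu>)\<close> is the Laplace transform of a
  chi-square variable with \<open>2 * \<mu>\<close> degrees of freedom; the value is its inverse
  moment of order \<open>Suc k\<close>.\<close>

lemma nn_integral_beta:
  fixes \<mu> :: real
  assumes "\<mu> > real k + 1"
  shows "(\<integral>\<^sup>+\<theta>. ennreal (\<theta> ^ k / fact k * (1 + 2 * \<theta>) powr (- \<mu>)) * indicator {0..} \<theta> \<partial>lborel)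
     = ennreal (1 / (\<Prod>j=1..Suc k. 2 * \<mu> - 2 * real j))"
proof -
  obtain F where F: "\<And>\<theta>. \<theta> \<ge> 0 \<Longrightarrow> (F has_real_derivative \<theta> ^ k / fact k * (1 + 2 * \<theta>) powr (- \<mu>)) (at \<theta>)"
     "F 0 = - (1 / (\<Prod>j=1..Suc k. 2 * \<mu> - 2 * real j))" "(F \<longlongrightarrow> 0) at_top"
    using beta_antiderivative[OF assms] by blast
  show ?thesis
    by (subst nn_integral_FTC_atLeast[OF _ F(1) _ F(3)]) (auto simp: F(2) simp del: prod.cl_ivl_Suc)
qed

text \<open>After an isometry that takes \<open>H\<close> into the coordinates outside
  \<open>S\<close>, the squared distance to \<open>H\<close> is at least the sum of squares of the
  coordinates in \<open>S\<close>, a chi-square variable with at least \<open>DIM('a) - h\<close>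
  degrees of freedom. The dimension is only bounded by \<open>h\<close> because \<open>H\<close>
  will be the image of a hyperplane under a possibly degenerate map; the bound on \<open>k\<close>
  keeps the inverse moment finite.\<close>

lemma nn_integral_infdist_gauss_le:
  fixes H :: "'a::euclidean_space set"
  assumes H: "subspace H" "dim H \<le> h" and k: "h + 2 * Suc k < DIM('a)"
  shows "(\<integral>\<^sup>+x. laplace_kernel k ((infdist x H)\<^sup>2) \<partial>gauss) \<le> ennreal (1 / (\<Prod>j=1..Suc k. real (DIM('a) - h) - 2 * real j))"
proof -
  obtain T :: "'a \<Rightarrow> 'a" and S where T: "linear T" "\<And>x. norm (T x) = norm x" and S: "S \<subseteq> Basis"
    "card S = DIM('a) - dim H" and TS: "\<And>x b. x \<in> H \<Longrightarrow> b \<in> S \<Longrightarrow> T x \<bullet> b = 0"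
    using isometry_onto_coordinates[OF H(1)] by metis
  have fin: "finite S" by (rule finite_subset[OF S(1) finite_Basis])
  define q where "q = (\<lambda>x::'a. \<Sum>b\<in>S. (x \<bullet> b)\<^sup>2)"
  have q_le: "q (T x) \<le> (infdist x H)\<^sup>2" for x
  proof -
    have "sqrt (q (T x)) \<le> dist x a" if "a \<in> H" for a
    proof -
      have "q (T x) = (\<Sum>b\<in>S. (T (x - a) \<bullet> b)\<^sup>2)"
        unfolding q_def using TS[OF that] T(1) by (intro sum.cong) (auto simp: linear_diff inner_diff_left)
      also have "\<dots> \<le> (\<Sum>b\<in>Basis. (T (x - a) \<bullet> b)\<^sup>2)" using S by (intro sum_mono2) auto
      also have "\<dots> = T (x - a) \<bullet> T (x - a)" by (subst euclidean_inner) (simp add: power2_eq_square)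
      also have "\<dots> = (dist x a)\<^sup>2" by (simp add: dot_square_norm T(2) dist_norm)
      finally show ?thesis by (simp add: real_le_lsqrt)
    qed
    moreover have "H \<noteq> {}" using H(1) subspace_0 by auto
    ultimately have "sqrt (q (T x)) \<le> infdist x H"
      unfolding infdist_def by (auto intro!: cINF_greatest)
    then have "(sqrt (q (T x)))\<^sup>2 \<le> (infdist x H)\<^sup>2" by (intro power_mono) (auto simp: q_def sum_nonneg)
    then show ?thesis by (simp add: q_def sum_nonneg)
  qed
  have [measurable]: "q \<in> borel_measurable borel" unfolding q_def by measurable
  have "(\<integral>\<^sup>+x. laplace_kernel k ((infdist x H)\<^sup>2) \<partial>gauss) \<le> (\<integral>\<^sup>+x. laplace_kernel k (q (T x)) \<partial>gauss)"
    by (intro nn_integral_mono laplace_kernel_antimono q_le)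
  also have "\<dots> = (\<integral>\<^sup>+x. laplace_kernel k (q x) \<partial>gauss)"
    by (rule nn_integral_gauss_isometry[OF T]) measurable
  also have "\<dots> = (\<integral>\<^sup>+\<theta>. \<integral>\<^sup>+x. ennreal (\<theta> ^ k / fact k * exp (- \<theta> * q x)) * indicator {0..} \<theta> \<partial>gauss \<partial>lborel)"
  proof -
    interpret prob_space "gauss :: 'a measure" by (rule prob_space_gauss)
    interpret pair_sigma_finite "gauss :: 'a measure" "lborel :: real measure" ..
    show ?thesis unfolding laplace_kernel_def by (rule Fubini'[symmetric]) measurable
  qed
  also have "\<dots> \<le> (\<integral>\<^sup>+\<theta>. ennreal (\<theta> ^ k / fact k * (1 + 2 * \<theta>) powr (- (real (DIM('a) - h) / 2))) * indicator {0..} \<theta> \<partial>lborel)"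
  proof (rule nn_integral_mono)
    fix \<theta> :: real
    show "(\<integral>\<^sup>+x. ennreal (\<theta> ^ k / fact k * exp (- \<theta> * q x)) * indicator {0..} \<theta> \<partial>gauss)
      \<le> ennreal (\<theta> ^ k / fact k * (1 + 2 * \<theta>) powr (- (real (DIM('a) - h) / 2))) * indicator {0..} \<theta>"
    proof (cases "\<theta> \<ge> 0")
      case True
      have "(\<integral>\<^sup>+x. ennreal (\<theta> ^ k / fact k * exp (- \<theta> * q x)) * indicator {0..} \<theta> \<partial>gauss)
        = (\<integral>\<^sup>+x. ennreal (\<theta> ^ k / fact k) * ennreal (exp ((- \<theta>) * (\<Sum>b\<in>S. (x \<bullet> b)\<^sup>2))) \<partial>gauss)"
        using True by (simp add: q_def ennreal_mult[symmetric])
      also have "\<dots> = ennreal (\<theta> ^ k / fact k) * (\<integral>\<^sup>+x. ennreal (exp ((- \<theta>) * (\<Sum>b\<in>S. (x \<bullet> b)\<^sup>2))) \<partial>gauss)"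
        by (rule nn_integral_cmult) simp
      also have "\<dots> = ennreal (\<theta> ^ k / fact k) * ennreal ((1 - 2 * (- \<theta>)) powr (- (real (card S) / 2)))"
        using True S by (subst nn_integral_exp_square_gauss) auto
      also have "\<dots> \<le> ennreal (\<theta> ^ k / fact k) * ennreal ((1 + 2 * \<theta>) powr (- (real (DIM('a) - h) / 2)))"
        using True S(2) H(2) by (intro mult_left_mono ennreal_leI) (auto intro!: powr_mono)
      finally show ?thesis using True by (simp add: ennreal_mult[symmetric])
    qed simp
  qed
  also have "\<dots> = ennreal (1 / (\<Prod>j=1..Suc k. real (DIM('a) - h) - 2 * real j))"
  proof -
    have "2 * (real (DIM('a) - h) / 2) = real (DIM('a) - h)" by simp
    moreover have "real (DIM('a) - h) / 2 > real k + 1"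
    proof -
      have "real (h + 2 * Suc k) < real DIM('a)" "h < DIM('a)" using k by (simp_all only: of_nat_less_iff)
      then show ?thesis by (simp add: of_nat_diff)
    qed
    ultimately show ?thesis using nn_integral_beta[of k "real (DIM('a) - h) / 2"] by (simp only:)
  qed
  finally show ?thesis .
qed

section \<open>Tails of the extremal gains of a Gaussian matrix\<close>

lemma continuous_on_matrix_vector_mult [continuous_intros]:
  fixes f :: "'a::topological_space \<Rightarrow> real^'m^'l"
  assumes "continuous_on S f" "continuous_on S g"
  shows "continuous_on S (\<lambda>x. f x *v g x)"
  unfolding matrix_vector_mult_def using assms by (intro continuous_intros)

lemma measurable_matrix_vector_mult [measurable]:
  fixes f :: "'a \<Rightarrow> real^'m^'l"
  assumes [measurable]: "f \<in> borel_measurable M" "g \<in> borel_measurable M"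
  shows "(\<lambda>x. f x *v g x) \<in> borel_measurable M"
  by (rule borel_measurable_continuous_Pair) (auto intro!: continuous_intros)

lemma linear_measurable [measurable_dest]:
  fixes T :: "'a::euclidean_space \<Rightarrow> 'b::euclidean_space"
  shows "linear T \<Longrightarrow> T \<in> borel_measurable borel"
  using linear_continuous_on[of T UNIV] by (intro borel_measurable_continuous_onI) (simp add: linear_linear)

lemma linear_measurable_comp:
  fixes T :: "'a::euclidean_space \<Rightarrow> 'b::euclidean_space"
  assumes "linear T" "f \<in> borel_measurable M"
  shows "(\<lambda>x. T (f x)) \<in> borel_measurable M"
  using measurable_compose[OF assms(2) linear_measurable[OF assms(1)]] .

section \<open>Separating one direction of a Gaussian matrix from the others\<close>

definition replace_along :: "real^'m \<Rightarrow> real^'m^'l \<Rightarrow> real^'l \<Rightarrow> real^'m^'l" where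
  "replace_along y X Z = (\<chi> i. X $ i + (Z $ i - X $ i \<bullet> y) *\<^sub>R y)"

lemma replace_along_nth: "replace_along y X Z $ i = X $ i + (Z $ i - X $ i \<bullet> y) *\<^sub>R y"
  by (simp add: replace_along_def)

text \<open>For a unit vector \<open>y\<close>, the new matrix sends \<open>y\<close> to
  \<open>Z\<close> and agrees with \<open>X\<close> on the orthogonal complement of
  \<open>y\<close>. In the decoupled integral the image of \<open>y\<close> is therefore independent
  of the image of that complement.\<close>

lemma replace_along_mult: "replace_along y X Z *v u = X *v u + (y \<bullet> u) *\<^sub>R (Z - X *v y)"
  by (simp add: vec_eq_iff matrix_vector_mul_component replace_along_def inner_add_left inner_scaleR_left algebra_simps)

text \<open>\<open>(X, Z) \<mapsto> (replace_along y X Z, X *v y)\<close> is an orthogonal involution: it exchanges \<open>Z\<close> with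
  the component of \<open>X\<close> along \<open>y\<close>.\<close>
lemma nn_integral_gauss_decouple:
  fixes y :: "real^'m" and f :: "real^'m^'l \<Rightarrow> ennreal"
  assumes y: "norm y = 1" and f [measurable]: "f \<in> borel_measurable borel"
  shows "(\<integral>\<^sup>+X. f X \<partial>gauss) = (\<integral>\<^sup>+X. \<integral>\<^sup>+Z. f (replace_along y X Z) \<partial>gauss \<partial>gauss)"
proof -
  define S :: "(real^'m^'l) \<times> (real^'l) \<Rightarrow> (real^'m^'l) \<times> (real^'l)" where
    "S = (\<lambda>(X, Z). (replace_along y X Z, X *v y))"
  have yy: "y \<bullet> y = 1" using y by (simp add: norm_eq_1)
  have linS: "linear S"
    by (rule linearI) (auto simp: S_def replace_along_def vec_eq_iff matrix_vector_mul_component inner_add_left algebra_simps)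
  have normS: "norm (S p) = norm p" for p
  proof -
    obtain X Z where p: "p = (X, Z)" by (cases p)
    have "S p \<bullet> S p = (\<Sum>i\<in>UNIV. (X $ i + (Z $ i - X $ i \<bullet> y) *\<^sub>R y) \<bullet> (X $ i + (Z $ i - X $ i \<bullet> y) *\<^sub>R y) + (X $ i \<bullet> y) * (X $ i \<bullet> y))"
      by (simp add: p S_def inner_Pair inner_vec_def[of "replace_along y X Z"] inner_vec_def[of "X *v y"]
          replace_along_nth matrix_vector_mul_component sum.distrib)
    also have "\<dots> = (\<Sum>i\<in>UNIV. X $ i \<bullet> X $ i + Z $ i * Z $ i)"
    proof (rule sum.cong[OF refl])
      fix i
      have "(X $ i + (Z $ i - X $ i \<bullet> y) *\<^sub>R y) \<bullet> (X $ i + (Z $ i - X $ i \<bullet> y) *\<^sub>R y)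
        = X $ i \<bullet> X $ i + 2 * (Z $ i - X $ i \<bullet> y) * (X $ i \<bullet> y) + (Z $ i - X $ i \<bullet> y) * (Z $ i - X $ i \<bullet> y)"
        by (simp add: inner_add_left inner_add_right yy inner_commute[of y "X $ i"] algebra_simps)
      then show "(X $ i + (Z $ i - X $ i \<bullet> y) *\<^sub>R y) \<bullet> (X $ i + (Z $ i - X $ i \<bullet> y) *\<^sub>R y) + (X $ i \<bullet> y) * (X $ i \<bullet> y)
         = X $ i \<bullet> X $ i + Z $ i * Z $ i" by (simp add: algebra_simps)
    qed
    also have "\<dots> = p \<bullet> p"
      by (simp add: p inner_Pair inner_vec_def[of X] inner_vec_def[of Z] sum.distrib)
    finally show ?thesis by (simp add: norm_eq)
  qed
  have fst_S: "fst (S (X, Z)) = replace_along y X Z" for X Z by (simp add: S_def)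
  have [measurable]: "(\<lambda>p. f (fst p)) \<in> borel_measurable (borel :: ((real^'m^'l) \<times> (real^'l)) measure)"
    by (rule measurable_compose[OF _ f]) (auto intro!: borel_measurable_continuous_onI continuous_intros)
  have mS: "(\<lambda>p. f (fst (S p))) \<in> borel_measurable (borel :: ((real^'m^'l) \<times> (real^'l)) measure)"
    using measurable_compose[OF linear_measurable[OF linS], of "\<lambda>p. f (fst p)" borel] by simp
  \<comment> \<open>The dummy variable \<open>Z\<close> supplies the second component on which the
    isometry \<open>S\<close> acts.\<close>
  have "(\<integral>\<^sup>+X. f X \<partial>gauss) = (\<integral>\<^sup>+X. \<integral>\<^sup>+(Z :: real^'l). f (fst (X, Z)) \<partial>gauss \<partial>gauss)"
    using prob_space.emeasure_space_1[OF prob_space_gauss[where 'a = "real^'l"]] by simp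
  also have "\<dots> = (\<integral>\<^sup>+p. f (fst (p :: (real^'m^'l) \<times> (real^'l))) \<partial>gauss)"
    by (rule nn_integral_gauss_pair) measurable
  also have "\<dots> = (\<integral>\<^sup>+p. f (fst (S p)) \<partial>gauss)"
    by (rule nn_integral_gauss_isometry[OF linS normS, symmetric]) measurable
  also have "\<dots> = (\<integral>\<^sup>+X. \<integral>\<^sup>+Z. f (fst (S (X, Z))) \<partial>gauss \<partial>gauss)"
    by (rule nn_integral_gauss_pair[OF mS, symmetric])
  finally show ?thesis unfolding fst_S .
qed

lemma nn_integral_gauss_mult_unit:
  fixes y :: "real^'m" and g :: "real^'l \<Rightarrow> ennreal"
  assumes y: "norm y = 1" and [measurable]: "g \<in> borel_measurable borel"
  shows "(\<integral>\<^sup>+X. g (X *v y) \<partial>gauss) = (\<integral>\<^sup>+Z. g Z \<partial>gauss)"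
proof -
  have "y \<bullet> y = 1" using y by (simp add: norm_eq_1)
  then have "replace_along y X Z *v y = Z" for X :: "real^'m^'l" and Z by (simp add: replace_along_mult)
  moreover have "(\<integral>\<^sup>+X. g (X *v y) \<partial>gauss) = (\<integral>\<^sup>+X. \<integral>\<^sup>+Z. g (replace_along y X Z *v y) \<partial>gauss \<partial>gauss)"
    by (rule nn_integral_gauss_decouple[OF y]) measurable
  ultimately show ?thesis
    using prob_space.emeasure_space_1[OF prob_space_gauss[where 'a = "real^'m^'l"]] by simp
qed

text \<open>Projection along a compact factor preserves closedness. Hence events that quantify over
  the uncountably many unit vectors are closed, and so Borel.\<close>

lemma closed_compact_existential:
  fixes K :: "'a::euclidean_space set" and T :: "('a \<times> 'b::euclidean_space) set"
  assumes "compact K" "closed T"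
  shows "closed {x. \<exists>v\<in>K. (v, x) \<in> T}"
proof -
  have "closedin (top_of_set (K \<times> UNIV)) ((K \<times> UNIV) \<inter> T)"
    by (intro closedin_closed_Int assms(2))
  then have "closedin (top_of_set UNIV) {x. \<exists>v. v \<in> K \<and> (v, x) \<in> (K \<times> UNIV) \<inter> T}"
    by (rule closedin_compact_projection[OF assms(1)])
  moreover have "{x. \<exists>v. v \<in> K \<and> (v, x) \<in> (K \<times> UNIV) \<inter> T} = {x. \<exists>v\<in>K. (v, x) \<in> T}" by auto
  ultimately show ?thesis by simp
qed

lemma nn_integral_gauss_swap:
  assumes [measurable]: "(\<lambda>p. f (fst p) (snd p)) \<in> borel_measurable (borel \<Otimes>\<^sub>M borel)"
  shows "(\<integral>\<^sup>+(x::'a::euclidean_space). \<integral>\<^sup>+(y::'b::euclidean_space). f x y \<partial>gauss \<partial>gauss) = (\<integral>\<^sup>+y. \<integral>\<^sup>+x. f x y \<partial>gauss \<partial>gauss)"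
proof -
  interpret A: prob_space "gauss :: 'a measure" by (rule prob_space_gauss)
  interpret B: prob_space "gauss :: 'b measure" by (rule prob_space_gauss)
  interpret pair_sigma_finite "gauss :: 'a measure" "gauss :: 'b measure" ..
  have "sets (gauss \<Otimes>\<^sub>M gauss) = sets (borel \<Otimes>\<^sub>M borel :: ('a \<times> 'b) measure)"
    by (intro sets_pair_measure_cong) simp_all
  then show ?thesis using assms
    by (intro Fubini'[symmetric]) (simp add: split_beta' cong: measurable_cong_sets)
qed

lemma closed_gain_ge:
  fixes B :: "real^'n \<Rightarrow> real^'m"
  assumes B: "linear B"
  shows "closed {X :: real^'m^'l. \<exists>v. norm v = 1 \<and> a \<le> norm (X *v B v)}"
proof -
  have contB: "continuous_on UNIV B" using B by (simp add: linear_continuous_on linear_linear)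
  note [continuous_intros] = continuous_on_compose2[OF contB]
  have "closed {p :: (real^'n) \<times> (real^'m^'l). a \<le> norm (snd p *v B (fst p))}"
    by (intro closed_Collect_le continuous_intros) auto
  from closed_compact_existential[OF compact_sphere[of 0 1] this]
  show ?thesis by (simp add: Bex_def)
qed

lemma closed_gain_le:
  fixes B :: "real^'n \<Rightarrow> real^'m"
  assumes B: "linear B"
  shows "closed {X :: real^'m^'l. \<exists>v. norm v = 1 \<and> norm (X *v B v) \<le> b}"
proof -
  have contB: "continuous_on UNIV B" using B by (simp add: linear_continuous_on linear_linear)
  note [continuous_intros] = continuous_on_compose2[OF contB]
  have "closed {p :: (real^'n) \<times> (real^'m^'l). norm (snd p *v B (fst p)) \<le> b}"
    by (intro closed_Collect_le continuous_intros) auto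
  from closed_compact_existential[OF compact_sphere[of 0 1] this]
  show ?thesis by (simp add: Bex_def)
qed

lemma largest_gain_tail:
  fixes B :: "real^'n \<Rightarrow> real^'m" and a :: real and p :: nat
  assumes B: "linear B" "\<And>v. norm (B v) = norm v" and a: "a > 0"
  defines "E \<equiv> {X :: real^'m^'l. \<exists>v. norm v = 1 \<and> a \<le> norm (X *v B v)}"
  shows "emeasure gauss E * ennreal (a ^ (2 * p) * (fact (2 * p) / (2 ^ p * fact p)))
     \<le> (\<integral>\<^sup>+w. ennreal (norm (w :: real^'n) ^ (2 * p)) \<partial>gauss) * (\<integral>\<^sup>+Z. ennreal (norm (Z :: real^'l) ^ (2 * p)) \<partial>gauss)"
proof -
  have E: "E \<in> sets borel" unfolding E_def by (intro borel_closed closed_gain_ge B(1))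
  note linear_measurable_comp[OF B(1), measurable]
  let ?c = "fact (2 * p) / (2 ^ p * fact p) :: real"
  have lower: "indicator E X * ennreal (a ^ (2 * p) * ?c) \<le> (\<integral>\<^sup>+w. ennreal (norm (X *v B w) ^ (2 * p)) \<partial>gauss)" for X :: "real^'m^'l"
  proof (cases "X \<in> E")
    case True
    then obtain v where v: "norm v = 1" "a \<le> norm (X *v B v)" by (auto simp: E_def)
    define L where "L = (\<lambda>w. X *v B w)"
    have L: "linear L" unfolding L_def using linear_compose[OF B(1) matrix_vector_mul_linear[of X]] by (simp add: o_def)
    \<comment> \<open>The vector \<open>v\<close> may depend on \<open>X\<close>, which is fixed
      here. \<open>q \<bullet> w\<close> is the component of \<open>L w\<close> along
      \<open>L v\<close>: it is at most \<open>norm (L w)\<close> in absolute value, and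
      \<open>norm q \<ge> q \<bullet> v = norm (L v)\<close>.\<close>
    define u where "u = L v /\<^sub>R norm (L v)"
    define q where "q = adjoint L u"
    have Lv: "norm (L v) > 0" unfolding L_def using v a by linarith
    have u: "norm u = 1" using Lv by (simp add: u_def)
    have q: "q \<bullet> w = u \<bullet> L w" for w using adjoint_works[OF L, of w u] by (simp add: q_def inner_commute)
    have "norm (L v) = q \<bullet> v" using Lv by (simp add: q u_def dot_square_norm power2_eq_square)
    also have "\<dots> \<le> norm q * norm v" by (rule norm_cauchy_schwarz)
    finally have "a \<le> norm q" using v by (simp add: L_def)
    then have "indicator E X * ennreal (a ^ (2 * p) * ?c) \<le> ennreal (norm q ^ (2 * p) * ?c)"
      using True mult_right_mono[OF power_mono[OF \<open>a \<le> norm q\<close>, of "2 * p"], of ?c] a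
      by (simp add: ennreal_leI del: fact_Suc times_divide_eq_right)
    also have "\<dots> = (\<integral>\<^sup>+w. ennreal ((q \<bullet> w) ^ (2 * p)) \<partial>gauss)"
      by (rule nn_integral_even_moment_inner_gauss[symmetric])
    also have "\<dots> \<le> (\<integral>\<^sup>+w. ennreal (norm (L w) ^ (2 * p)) \<partial>gauss)"
    proof (intro nn_integral_mono ennreal_leI)
      fix w
      have "\<bar>q \<bullet> w\<bar> \<le> norm u * norm (L w)" unfolding q by (rule Cauchy_Schwarz_ineq2)
      then have "\<bar>q \<bullet> w\<bar> ^ (2 * p) \<le> norm (L w) ^ (2 * p)" using u by (intro power_mono) auto
      then show "(q \<bullet> w) ^ (2 * p) \<le> norm (L w) ^ (2 * p)" by (simp add: power_even_abs)
    qed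
    finally show ?thesis by (simp add: L_def)
  qed simp
  have "emeasure gauss E * ennreal (a ^ (2 * p) * ?c) = (\<integral>\<^sup>+X. indicator E X * ennreal (a ^ (2 * p) * ?c) \<partial>gauss)"
    using E by (subst nn_integral_multc) auto
  also have "\<dots> \<le> (\<integral>\<^sup>+X. \<integral>\<^sup>+w. ennreal (norm (X *v B w) ^ (2 * p)) \<partial>gauss \<partial>(gauss :: (real^'m^'l) measure))"
    by (intro nn_integral_mono lower)
  also have "\<dots> = (\<integral>\<^sup>+w. \<integral>\<^sup>+X. ennreal (norm (X *v B w) ^ (2 * p)) \<partial>(gauss :: (real^'m^'l) measure) \<partial>gauss)"
    by (rule nn_integral_gauss_swap) measurable
  also have "\<dots> \<le> (\<integral>\<^sup>+w. ennreal (norm (w :: real^'n) ^ (2 * p)) * (\<integral>\<^sup>+Z. ennreal (norm (Z :: real^'l) ^ (2 * p)) \<partial>gauss) \<partial>gauss)"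
  proof (rule nn_integral_mono)
    fix w :: "real^'n"
    show "(\<integral>\<^sup>+X. ennreal (norm (X *v B w) ^ (2 * p)) \<partial>(gauss :: (real^'m^'l) measure))
      \<le> ennreal (norm w ^ (2 * p)) * (\<integral>\<^sup>+Z. ennreal (norm (Z :: real^'l) ^ (2 * p)) \<partial>gauss)"
    proof (cases "w = 0")
      case True
      then have "B w = 0" using B(2)[of w] by simp
      then show ?thesis using True prob_space.emeasure_space_1[OF prob_space_gauss[where 'a = "real^'m^'l"]]
          prob_space.emeasure_space_1[OF prob_space_gauss[where 'a = "real^'l"]]
        by (cases "p = 0") (auto simp: zero_power)
    next
      case False
      define y where "y = B (w /\<^sub>R norm w)"
      have y: "norm y = 1" using False by (simp add: y_def B(2))
      have "B w = norm w *\<^sub>R y" using False B(1) by (simp add: y_def linear_scale)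
      then have "(\<integral>\<^sup>+X. ennreal (norm (X *v B w) ^ (2 * p)) \<partial>(gauss :: (real^'m^'l) measure))
        = (\<integral>\<^sup>+X. ennreal (norm w ^ (2 * p)) * ennreal (norm (X *v y) ^ (2 * p)) \<partial>(gauss :: (real^'m^'l) measure))"
        by (simp add: matrix_vector_mult_scaleR power_mult_distrib ennreal_mult)
      also have "\<dots> = ennreal (norm w ^ (2 * p)) * (\<integral>\<^sup>+X. ennreal (norm (X *v y) ^ (2 * p)) \<partial>(gauss :: (real^'m^'l) measure))"
        by (rule nn_integral_cmult) measurable
      also have "(\<integral>\<^sup>+X. ennreal (norm (X *v y) ^ (2 * p)) \<partial>(gauss :: (real^'m^'l) measure)) = (\<integral>\<^sup>+Z. ennreal (norm (Z :: real^'l) ^ (2 * p)) \<partial>gauss)"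
        by (rule nn_integral_gauss_mult_unit[OF y]) measurable
      finally show ?thesis by simp
    qed
  qed
  also have "\<dots> = (\<integral>\<^sup>+w. ennreal (norm (w :: real^'n) ^ (2 * p)) \<partial>gauss) * (\<integral>\<^sup>+Z. ennreal (norm (Z :: real^'l) ^ (2 * p)) \<partial>gauss)"
    by (rule nn_integral_multc) measurable
  finally show "emeasure gauss E * ennreal (a ^ (2 * p) * ?c)
     \<le> (\<integral>\<^sup>+w. ennreal (norm (w :: real^'n) ^ (2 * p)) \<partial>gauss) * (\<integral>\<^sup>+Z. ennreal (norm (Z :: real^'l) ^ (2 * p)) \<partial>gauss)" .
qed

text \<open>The distance from the image of the direction \<open>w\<close> to the image of its orthogonal complement. It is
  at most \<open>norm (L v) / \<bar>cos\<bar>\<close> of the angle between \<open>v\<close> and \<open>w\<close>, for every unit vector \<open>v\<close>.\<close>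
definition split_dist :: "('a::euclidean_space \<Rightarrow> 'b::euclidean_space) \<Rightarrow> 'a \<Rightarrow> real" where
  "split_dist L w = infdist (L (w /\<^sub>R norm w)) (L ` {u. u \<bullet> w = 0})"

lemma split_dist_le:
  assumes L: "linear L" and vw: "v \<bullet> w \<noteq> 0"
  shows "split_dist L w \<le> norm (L v) * norm w / \<bar>v \<bullet> w\<bar>"
proof -
  define s where "s = (v \<bullet> w) / norm w"
  have w: "w \<noteq> 0" using vw by auto
  have s: "s \<noteq> 0" using vw w by (simp add: s_def)
  \<comment> \<open>\<open>v\<close> is \<open>s\<close> times the direction of \<open>w\<close>
    plus \<open>u\<close>, with \<open>u\<close> orthogonal to \<open>w\<close>; so that direction
    minus the hyperplane point \<open>- u / s\<close> is \<open>v / s\<close>.\<close>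
  define u where "u = v - s *\<^sub>R (w /\<^sub>R norm w)"
  have "u \<bullet> w = 0"
    using w by (simp add: u_def s_def inner_diff_left dot_square_norm power2_eq_square)
  then have "(- (1 / s)) *\<^sub>R u \<in> {u. u \<bullet> w = 0}" by simp
  then have "split_dist L w \<le> dist (L (w /\<^sub>R norm w)) (L ((- (1 / s)) *\<^sub>R u))"
    unfolding split_dist_def by (intro infdist_le imageI)
  also have "\<dots> = norm (L (w /\<^sub>R norm w - (- (1 / s)) *\<^sub>R u))"
    by (simp only: dist_norm linear_diff[OF L])
  also have "w /\<^sub>R norm w - (- (1 / s)) *\<^sub>R u = (1 / s) *\<^sub>R v"
    using s by (simp add: u_def algebra_simps)
  also have "norm (L ((1 / s) *\<^sub>R v)) = norm (L v) / \<bar>s\<bar>"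
    by (simp add: linear_scale[OF L])
  also have "\<dots> = norm (L v) * norm w / \<bar>v \<bullet> w\<bar>" by (simp add: s_def)
  finally show ?thesis .
qed

text \<open>The hyperplane in \<open>split_dist\<close> moves with \<open>w\<close>. Projecting
  every \<open>u\<close> onto it turns the infimum into one over a fixed space, and by continuity in
  \<open>u\<close> a countable dense set suffices.\<close>

lemma split_dist_measurable:
  fixes B :: "real^'n \<Rightarrow> real^'m"
  assumes B: "linear B"
  shows "(\<lambda>p. split_dist (\<lambda>u. fst p *v B u) (snd p)) \<in> borel_measurable (borel \<Otimes>\<^sub>M borel :: ((real^'m^'l) \<times> (real^'n)) measure)"
proof -
  note linear_measurable_comp[OF B, measurable]
  have contB: "continuous_on UNIV B" using B by (simp add: linear_continuous_on linear_linear)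
  note [continuous_intros] = continuous_on_compose2[OF contB]
  obtain U :: "(real^'n) set" where U: "countable U" "\<And>S. open S \<Longrightarrow> S \<noteq> {} \<Longrightarrow> \<exists>u\<in>U. u \<in> S"
    using countable_dense_exists by metis
  define h :: "real^'n \<Rightarrow> (real^'m^'l) \<times> (real^'n) \<Rightarrow> real" where
    "h = (\<lambda>u p. dist (fst p *v B (snd p /\<^sub>R norm (snd p))) (fst p *v B (u - (u \<bullet> (snd p /\<^sub>R norm (snd p))) *\<^sub>R (snd p /\<^sub>R norm (snd p)))))"
  have h [measurable]: "h u \<in> borel_measurable (borel \<Otimes>\<^sub>M borel)" for u
    unfolding h_def by measurable
  have "{p. split_dist (\<lambda>u. fst p *v B u) (snd p) < c} = (\<Union>u\<in>U. {p. h u p < c})" for c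
  proof (intro set_eqI iffI)
    fix p :: "(real^'m^'l) \<times> (real^'n)"
    obtain X w where p: "p = (X, w)" by (cases p)
    define e where "e = w /\<^sub>R norm w"
    have proj: "(u - (u \<bullet> e) *\<^sub>R e) \<bullet> w = 0" for u
      by (cases "w = 0") (simp_all add: e_def inner_diff_left dot_square_norm power2_eq_square divide_simps)
    {
      assume "p \<in> {p. split_dist (\<lambda>u. fst p *v B u) (snd p) < c}"
      then have less: "infdist (X *v B e) ((\<lambda>u. X *v B u) ` {u. u \<bullet> w = 0}) < c"
        by (simp add: split_dist_def p e_def)
      have "0 \<in> {u. u \<bullet> w = 0}" by simp
      then have ne: "(\<lambda>u. X *v B u) ` {u. u \<bullet> w = 0} \<noteq> {}" by blast
      have "\<exists>d\<in>dist (X *v B e) ` (\<lambda>u. X *v B u) ` {u. u \<bullet> w = 0}. d < c"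
        using less unfolding infdist_notempty[OF ne] by (rule cInf_lessD[rotated]) (use ne in blast)
      then obtain u where u: "u \<bullet> w = 0" "dist (X *v B e) (X *v B u) < c" by blast
      then have "u \<in> {u. h u p < c}" by (simp add: h_def p e_def[symmetric])
      moreover have "open {u. h u p < c}"
        unfolding h_def by (intro open_Collect_less continuous_intros) auto
      ultimately show "p \<in> (\<Union>u\<in>U. {p. h u p < c})" using U(2)[of "{u. h u p < c}"] by auto
    }
    {
      assume "p \<in> (\<Union>u\<in>U. {p. h u p < c})"
      then obtain u where u: "h u p < c" by auto
      have "infdist (X *v B e) ((\<lambda>u. X *v B u) ` {u. u \<bullet> w = 0}) \<le> dist (X *v B e) (X *v B (u - (u \<bullet> e) *\<^sub>R e))"
        using proj[of u] by (intro infdist_le imageI) simp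
      then show "p \<in> {p. split_dist (\<lambda>u. fst p *v B u) (snd p) < c}"
        using u by (simp add: h_def split_dist_def p e_def)
    }
  qed
  moreover have "{p. h u p < c} \<in> sets (borel \<Otimes>\<^sub>M borel)" for u c
  proof -
    have "{p \<in> space (borel \<Otimes>\<^sub>M borel). h u p < c} \<in> sets (borel \<Otimes>\<^sub>M borel)" by measurable
    then show ?thesis by (simp add: space_pair_measure)
  qed
  ultimately show ?thesis
    using U(1) by (subst borel_measurable_iff_less) (auto simp: space_pair_measure intro!: sets.countable_UN')
qed

text \<open>The factor \<open>norm w ^ (2 * Suc k)\<close> cancels the length of \<open>w\<close> in
  \<open>split_dist_le\<close>; for \<open>X\<close> in \<open>E\<close>, its product with the
  inverse power of the split distance dominates
  \<open>((v /\<^sub>R b) \<bullet> w) ^ (2 * Suc k)\<close>, whose integral is known. For fixed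
  \<open>w\<close>, decoupling turns the split distance into that of a Gaussian vector from an
  independent subspace of dimension at most \<open>CARD('n) - 1\<close>.\<close>

lemma smallest_gain_tail:
  fixes B :: "real^'n \<Rightarrow> real^'m" and b :: real and k :: nat
  assumes B: "linear B" "\<And>v. norm (B v) = norm v" and b: "b > 0"
    and k: "CARD('n) - 1 + 2 * Suc k < CARD('l)"
  defines "E \<equiv> {X :: real^'m^'l. \<exists>v. norm v = 1 \<and> norm (X *v B v) \<le> b}"
  shows "emeasure gauss E * ennreal ((1 / b) ^ (2 * Suc k) * (fact (2 * Suc k) / (2 ^ Suc k * fact (Suc k))))
     \<le> (\<integral>\<^sup>+w. ennreal (norm (w :: real^'n) ^ (2 * Suc k)) \<partial>gauss)
         * ennreal (1 / (\<Prod>j=1..Suc k. real (CARD('l) - (CARD('n) - 1)) - 2 * real j))"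
proof -
  have E: "E \<in> sets borel" unfolding E_def by (intro borel_closed closed_gain_le B(1))
  note linear_measurable_comp[OF B(1), measurable]
  define q where "q = 2 * Suc k"
  define c :: real where "c = fact (2 * Suc k) / (2 ^ Suc k * fact (Suc k))"
  define C where "C = ennreal (1 / (\<Prod>j=1..Suc k. real (CARD('l) - (CARD('n) - 1)) - 2 * real j))"
  have c: "c \<ge> 0" by (simp add: c_def)
  define D where "D = (\<lambda>(X :: real^'m^'l) w. split_dist (\<lambda>u. X *v B u) w)"
  have D [measurable]: "(\<lambda>p. D (fst p) (snd p)) \<in> borel_measurable (borel \<Otimes>\<^sub>M borel)"
    unfolding D_def by (rule split_dist_measurable[OF B(1)])
  have D1 [measurable]: "(\<lambda>X. D X w) \<in> borel_measurable borel" for w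
    using measurable_compose[OF _ D, of "\<lambda>X. (X, w)" borel] by simp
  have linXB: "linear (\<lambda>u. X *v B u)" for X :: "real^'m^'l"
    using linear_compose[OF B(1) matrix_vector_mul_linear[of X]] by (simp add: o_def)
  have innerB: "B u \<bullet> B v = u \<bullet> v" for u v
    using B by (simp add: dot_norm linear_add[symmetric])
  have lower: "indicator E X * ennreal ((1 / b) ^ q * c) \<le> (\<integral>\<^sup>+w. ennreal (norm w ^ q) * laplace_kernel k ((D X w)\<^sup>2) \<partial>gauss)" for X :: "real^'m^'l"
  proof (cases "X \<in> E")
    case True
    then obtain v where v: "norm v = 1" "norm (X *v B v) \<le> b" by (auto simp: E_def)
    have "indicator E X * ennreal ((1 / b) ^ q * c) = ennreal (norm (v /\<^sub>R b) ^ (2 * Suc k) * (fact (2 * Suc k) / (2 ^ Suc k * fact (Suc k))))"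
    proof -
      have "norm (v /\<^sub>R b) = 1 / b" using v b by (simp add: inverse_eq_divide)
      then show ?thesis using True by (simp only: q_def c_def indicator_simps mult_1)
    qed
    also have "\<dots> = (\<integral>\<^sup>+w. ennreal (((v /\<^sub>R b) \<bullet> w) ^ (2 * Suc k)) \<partial>gauss)"
      by (rule nn_integral_even_moment_inner_gauss[symmetric])
    also have "\<dots> \<le> (\<integral>\<^sup>+w. ennreal (norm w ^ q) * laplace_kernel k ((D X w)\<^sup>2) \<partial>gauss)"
    proof (rule nn_integral_mono)
      fix w :: "real^'n"
      show "ennreal (((v /\<^sub>R b) \<bullet> w) ^ (2 * Suc k)) \<le> ennreal (norm w ^ q) * laplace_kernel k ((D X w)\<^sup>2)"
      proof (cases "v \<bullet> w = 0")
        case True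
        then show ?thesis by simp
      next
        case False
        then have w: "norm w > 0" by auto
        have "D X w \<le> norm (X *v B v) * norm w / \<bar>v \<bullet> w\<bar>"
          unfolding D_def by (rule split_dist_le[OF linXB False])
        also have "\<dots> \<le> b * norm w / \<bar>v \<bullet> w\<bar>" using v by (intro divide_right_mono mult_right_mono) auto
        finally have "(D X w)\<^sup>2 \<le> (b * norm w / \<bar>v \<bullet> w\<bar>)\<^sup>2"
          by (intro power_mono) (simp_all add: D_def split_dist_def infdist_nonneg)
        then have "laplace_kernel k ((b * norm w / \<bar>v \<bullet> w\<bar>)\<^sup>2) \<le> laplace_kernel k ((D X w)\<^sup>2)"
          by (rule laplace_kernel_antimono)
        moreover have "laplace_kernel k ((b * norm w / \<bar>v \<bullet> w\<bar>)\<^sup>2) = ennreal (1 / ((b * norm w / \<bar>v \<bullet> w\<bar>)\<^sup>2) ^ Suc k)"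
          using b w False by (intro laplace_kernel_eq) (auto intro!: zero_less_power)
        moreover have "ennreal (((v /\<^sub>R b) \<bullet> w) ^ (2 * Suc k)) = ennreal (norm w ^ q) * ennreal (1 / ((b * norm w / \<bar>v \<bullet> w\<bar>)\<^sup>2) ^ Suc k)"
        proof -
          have "((v /\<^sub>R b) \<bullet> w) ^ (2 * Suc k) = (norm w ^ 2) ^ Suc k * (1 / ((b * norm w / \<bar>v \<bullet> w\<bar>)\<^sup>2) ^ Suc k)"
            using w b False unfolding power_mult power_one_over[symmetric] power_mult_distrib[symmetric]
            by (intro arg_cong[of _ _ "\<lambda>x. x ^ Suc k"]) (simp add: power_divide power_mult_distrib divide_simps)
          also have "\<dots> = norm w ^ q * (1 / ((b * norm w / \<bar>v \<bullet> w\<bar>)\<^sup>2) ^ Suc k)"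
            by (simp only: q_def power_mult)
          finally show ?thesis by (simp only: ennreal_mult zero_le_power norm_ge_zero zero_le_divide_1_iff zero_le_power2)
        qed
        ultimately show ?thesis by (simp add: mult_left_mono del: power_Suc)
      qed
    qed
    finally show ?thesis .
  qed simp
  have upper: "(\<integral>\<^sup>+X. laplace_kernel k ((D X w)\<^sup>2) \<partial>gauss) \<le> C" if w: "w \<noteq> 0" for w
  proof -
    define y where "y = B (w /\<^sub>R norm w)"
    have y: "norm y = 1" using w by (simp add: y_def B(2))
    have yy: "y \<bullet> y = 1" using y by (simp add: norm_eq_1)
    define H where "H = (\<lambda>X :: real^'m^'l. (\<lambda>u. X *v B u) ` {u. u \<bullet> w = 0})"
    have D_replace: "D (replace_along y X Z) w = infdist Z (H X)" for X Z
    proof -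
      have "replace_along y X Z *v y = Z" by (simp add: replace_along_mult yy)
      \<comment> \<open>Only the direction \<open>y\<close> is altered, and \<open>B\<close> maps
        the hyperplane into the orthogonal complement of \<open>y\<close>.\<close>
      moreover have "(\<lambda>u. replace_along y X Z *v B u) ` {u. u \<bullet> w = 0} = H X"
        unfolding H_def
        by (intro image_cong refl) (simp add: replace_along_mult y_def innerB inner_commute)
      ultimately show ?thesis by (simp add: D_def split_dist_def y_def)
    qed
    have subsp: "subspace {u. u \<bullet> w = 0}" using subspace_hyperplane[of w] by (simp add: inner_commute)
    have "subspace (H X)" for X unfolding H_def by (rule linear_subspace_image[OF linXB subsp])
    moreover have "dim (H X) \<le> CARD('n) - 1" for X
    proof -
      have "dim (H X) \<le> dim {u. u \<bullet> w = 0}" unfolding H_def by (rule dim_image_le[OF linXB])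
      also have "\<dots> = CARD('n) - 1" using dim_hyperplane[OF w] by (simp add: inner_commute)
      finally show ?thesis .
    qed
    ultimately have "(\<integral>\<^sup>+Z. laplace_kernel k ((infdist Z (H X))\<^sup>2) \<partial>gauss) \<le> C" for X
      using nn_integral_infdist_gauss_le[of "H X" "CARD('n) - 1" k] k by (simp add: C_def)
    then have "(\<integral>\<^sup>+X. \<integral>\<^sup>+Z. laplace_kernel k ((D (replace_along y X Z) w)\<^sup>2) \<partial>gauss \<partial>gauss) \<le> (\<integral>\<^sup>+(X :: real^'m^'l). C \<partial>gauss)"
      unfolding D_replace by (intro nn_integral_mono)
    also have "\<dots> = C" using prob_space.emeasure_space_1[OF prob_space_gauss[where 'a = "real^'m^'l"]] by simp
    finally show ?thesis
      by (subst nn_integral_gauss_decouple[OF y]) simp_all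
  qed
  have "emeasure gauss E * ennreal ((1 / b) ^ q * c) = (\<integral>\<^sup>+X. indicator E X * ennreal ((1 / b) ^ q * c) \<partial>gauss)"
    using E by (subst nn_integral_multc) auto
  also have "\<dots> \<le> (\<integral>\<^sup>+X. \<integral>\<^sup>+w. ennreal (norm w ^ q) * laplace_kernel k ((D X w)\<^sup>2) \<partial>gauss \<partial>gauss)"
    by (intro nn_integral_mono lower)
  also have "\<dots> = (\<integral>\<^sup>+w. \<integral>\<^sup>+X. ennreal (norm w ^ q) * laplace_kernel k ((D X w)\<^sup>2) \<partial>gauss \<partial>gauss)"
    by (rule nn_integral_gauss_swap) measurable
  also have "\<dots> \<le> (\<integral>\<^sup>+w. ennreal (norm (w :: real^'n) ^ q) * C \<partial>gauss)"
  proof (rule nn_integral_mono)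
    fix w :: "real^'n"
    show "(\<integral>\<^sup>+X. ennreal (norm w ^ q) * laplace_kernel k ((D X w)\<^sup>2) \<partial>gauss) \<le> ennreal (norm w ^ q) * C"
    proof (cases "w = 0")
      case True
      then show ?thesis by (simp add: q_def)
    next
      case False
      then show ?thesis using upper[OF False] by (subst nn_integral_cmult) (auto intro!: mult_left_mono)
    qed
  qed
  also have "\<dots> = (\<integral>\<^sup>+w. ennreal (norm (w :: real^'n) ^ q) \<partial>gauss) * C"
    by (rule nn_integral_multc) measurable
  finally show "emeasure gauss E * ennreal ((1 / b) ^ (2 * Suc k) * (fact (2 * Suc k) / (2 ^ Suc k * fact (Suc k))))
     \<le> (\<integral>\<^sup>+w. ennreal (norm (w :: real^'n) ^ (2 * Suc k)) \<partial>gauss)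
         * ennreal (1 / (\<Prod>j=1..Suc k. real (CARD('l) - (CARD('n) - 1)) - 2 * real j))"
    unfolding q_def c_def C_def .
qed

lemma measure_gauss_le:
  assumes "emeasure gauss E * ennreal x \<le> ennreal y" "x \<ge> z" "z > 0" "y \<ge> 0"
  shows "measure (gauss :: 'a::euclidean_space measure) E \<le> y / z"
proof -
  interpret prob_space "gauss :: 'a measure" by (rule prob_space_gauss)
  have "ennreal (measure (gauss :: 'a measure) E * x) \<le> ennreal y"
    using assms by (simp add: emeasure_eq_measure ennreal_mult)
  then have "measure (gauss :: 'a measure) E * x \<le> y" using assms(4) by simp
  moreover have "measure (gauss :: 'a measure) E * z \<le> measure (gauss :: 'a measure) E * x"
    using assms(2) by (intro mult_left_mono) auto
  ultimately show ?thesis using assms(3) by (simp add: pos_le_divide_eq)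
qed

lemma largest_gain_bound:
  fixes B :: "real^'n \<Rightarrow> real^'m"
  assumes B: "linear B" "\<And>v. norm (B v) = norm v"
  defines "r \<equiv> sqrt CARD('n)" and "s \<equiv> sqrt CARD('l)"
  assumes rs: "r < s" and big: "(s - r)\<^sup>2 \<ge> 8 * ln 2"
  shows "measure gauss {X :: real^'m^'l. \<exists>v. norm v = 1 \<and> sqrt ((3 * s + r) * (3 * s + 4 * r) / 4) \<le> norm (X *v B v)}
     \<le> exp (- (s - r)\<^sup>2 / 8)"
proof -
  define A where "A = (3 * s + r) * (3 * s + 4 * r) / 4"
  define N L where "N = real CARD('n)" and "L = real CARD('l)"
  have r: "r \<ge> 1" by (simp add: r_def)
  have N: "r\<^sup>2 = N" and L: "s\<^sup>2 = L" by (auto simp: r_def s_def N_def L_def)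
  have A: "A > 0" using r rs by (auto simp: A_def)
  have sr: "s - r \<ge> 2349/1000"
  proof (rule power2_le_imp_le)
    show "(2349/1000)\<^sup>2 \<le> (s - r)\<^sup>2" using big ln_2_lower by (simp add: power2_eq_square)
  qed (use rs in simp)
  \<comment> \<open>\<open>2 * p\<close> is the largest even integer up to the upper end of the
    interval in \<open>largest_gain_exponent\<close>. The interval has length
    \<open>3/5 * s * r\<close>, which exceeds 2 because \<open>s * r \<ge> 3349/1000\<close>, so the
    lower end is respected too.\<close>
  define p where "p = nat \<lfloor>s * (5/4 * s + 7/2 * r) / 2\<rfloor>"
  have "0 \<le> s * (5/4 * s + 7/2 * r) / 2" using r rs by simp
  then have "real p \<le> s * (5/4 * s + 7/2 * r) / 2" "s * (5/4 * s + 7/2 * r) / 2 < real p + 1"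
    unfolding p_def by linarith+
  then have p: "2 * real p \<le> s * (5/4 * s + 7/2 * r)" "s * (5/4 * s + 7/2 * r) < 2 * real p + 2" by auto
  have "(2349/1000 + 1) * 1 \<le> s * r" using sr r by (intro mult_mono) auto
  then have p': "s * (5/4 * s + 29/10 * r) \<le> 2 * real p" using p(2) by (simp add: algebra_simps)
  let ?M = "\<lambda>N. exp (((N + 2 * real p) * ln (N + 2 * real p) - N * ln N - 2 * real p) / 2)"
  define z where "z = exp (real p * ln A) * exp (((2 * real p) * ln (2 * real p) - 2 * real p) / 2)"
  have "emeasure gauss {X :: real^'m^'l. \<exists>v. norm v = 1 \<and> sqrt A \<le> norm (X *v B v)} * ennreal (sqrt A ^ (2 * p) * (fact (2 * p) / (2 ^ p * fact p)))
    \<le> (\<integral>\<^sup>+w. ennreal (norm (w :: real^'n) ^ (2 * p)) \<partial>gauss) * (\<integral>\<^sup>+Z. ennreal (norm (Z :: real^'l) ^ (2 * p)) \<partial>gauss)"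
    using A by (intro largest_gain_tail[OF B]) auto
  also have "\<dots> \<le> ennreal (?M N) * ennreal (?M L)"
    using nn_integral_even_moment_gauss_le[of p, where 'a = "real^'n"] nn_integral_even_moment_gauss_le[of p, where 'a = "real^'l"]
    by (intro mult_mono) (simp_all add: N_def L_def)
  also have "\<dots> = ennreal (?M N * ?M L)" by (simp add: ennreal_mult)
  finally have "measure gauss {X :: real^'m^'l. \<exists>v. norm v = 1 \<and> sqrt A \<le> norm (X *v B v)} \<le> ?M N * ?M L / z"
  proof (rule measure_gauss_le)
    have "exp (real p * ln A) = sqrt A ^ (2 * p)"
      using A by (simp add: exp_of_nat_mult power_mult)
    then show "z \<le> sqrt A ^ (2 * p) * (fact (2 * p) / (2 ^ p * fact p))"
      unfolding z_def using fact_double_ratio_ge[of p] A by (simp only:) (intro mult_left_mono zero_le_power real_sqrt_ge_zero, auto)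
  qed (simp_all add: z_def)
  also have "\<dots> = exp ((((N + 2 * real p) * ln (N + 2 * real p) - N * ln N - 2 * real p)
      + ((L + 2 * real p) * ln (L + 2 * real p) - L * ln L - 2 * real p)
      - ((2 * real p) * ln (2 * real p) - 2 * real p) - (2 * real p) * ln A) / 2)"
    unfolding z_def exp_add[symmetric] exp_diff[symmetric] by (simp add: field_simps)
  also have "\<dots> \<le> exp (- (s - r)\<^sup>2 / 8)"
    using largest_gain_exponent[OF _ _ p' p(1)] r rs unfolding N L A_def[symmetric] by simp
  finally show ?thesis by (simp add: A_def)
qed

lemma smallest_gain_bound:
  fixes B :: "real^'n \<Rightarrow> real^'m"
  assumes B: "linear B" "\<And>v. norm (B v) = norm v"
  defines "r \<equiv> sqrt CARD('n)" and "s \<equiv> sqrt CARD('l)"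
  assumes rs: "r < s" and big: "(s - r)\<^sup>2 \<ge> 8 * ln 2"
  shows "measure gauss {X :: real^'m^'l. \<exists>v. norm v = 1 \<and> norm (X *v B v) \<le> sqrt ((s - r)\<^sup>2 * (3 * s + 4 * r) / (4 * (3 * s + r)))}
     \<le> exp (- (s - r)\<^sup>2 / 8)"
proof -
  define A where "A = (s - r)\<^sup>2 * (3 * s + 4 * r) / (4 * (3 * s + r))"
  define N d where "N = real CARD('n)" and "d = s\<^sup>2 - r\<^sup>2"
  have r: "r \<ge> 1" by (simp add: r_def)
  have N: "r\<^sup>2 = N" and d: "d = real CARD('l) - real CARD('n)" by (auto simp: r_def s_def N_def d_def)
  have A: "A > 0" using r rs by (auto simp: A_def)
  define p where "p = nat \<lfloor>(s - r) * (3/4 * s + r) / 2\<rfloor>"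
  have "0 \<le> (s - r) * (3/4 * s + r) / 2" using r rs by simp
  then have "real p \<le> (s - r) * (3/4 * s + r) / 2" "(s - r) * (3/4 * s + r) / 2 < real p + 1"
    unfolding p_def by linarith+
  then have p: "(s - r) * (3/4 * s + r) - 2 < 2 * real p" "2 * real p \<le> (s - r) * (3/4 * s + r)" by auto
  note exponent = smallest_gain_exponent[OF r rs big p, folded A_def d_def]
  \<comment> \<open>The index is \<open>p - 1\<close> because \<open>laplace_kernel k\<close> is an
    inverse power of order \<open>k + 1\<close>.\<close>
  obtain k where k: "p = Suc k" using exponent(2) by (cases p) auto
  have "real (2 * p) < real CARD('l) - real CARD('n)" using exponent(3) d by simp
  then have card: "CARD('n) - 1 + 2 * Suc k < CARD('l)" and le: "CARD('n) \<le> CARD('l)" unfolding k by linarith+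
  \<comment> \<open>There are \<open>d + 1\<close> rather than \<open>d\<close> degrees of freedom
    since the hyperplane has dimension \<open>CARD('n) - 1\<close>; this puts the factors exactly at
    the interval midpoints.\<close>
  have prod: "(\<Prod>j=1..Suc k. real (CARD('l) - (CARD('n) - 1)) - 2 * real j) = (\<Prod>j=1..p. d + 1 - 2 * real j)"
    unfolding k d using le by (intro prod.cong) (auto simp: of_nat_diff)
  let ?M = "exp (((N + 2 * real p) * ln (N + 2 * real p) - N * ln N - 2 * real p) / 2)"
  define w where "w = exp ((d * ln d - (d - 2 * real p) * ln (d - 2 * real p) - 2 * real p) / 2)"
  define z where "z = exp (- (real p * ln A)) * exp (((2 * real p) * ln (2 * real p) - 2 * real p) / 2)"
  have "emeasure gauss {X :: real^'m^'l. \<exists>v. norm v = 1 \<and> norm (X *v B v) \<le> sqrt A} * ennreal ((1 / sqrt A) ^ (2 * p) * (fact (2 * p) / (2 ^ p * fact p)))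
    \<le> (\<integral>\<^sup>+w. ennreal (norm (w :: real^'n) ^ (2 * p)) \<partial>gauss) * ennreal (1 / (\<Prod>j=1..p. d + 1 - 2 * real j))"
    unfolding prod[symmetric] unfolding k using A by (intro smallest_gain_tail[OF B _ card]) auto
  also have "\<dots> \<le> ennreal ?M * ennreal (1 / w)"
  proof (intro mult_mono ennreal_leI)
    show "(\<integral>\<^sup>+w. ennreal (norm (w :: real^'n) ^ (2 * p)) \<partial>gauss) \<le> ennreal ?M"
      using nn_integral_even_moment_gauss_le[of p, where 'a = "real^'n"] by (simp add: N_def)
    have "w \<le> (\<Prod>j=1..p. d + 1 - 2 * real j)"
      unfolding w_def using exponent(3) by (intro prod_arith_progression_ge) simp
    then show "1 / (\<Prod>j=1..p. d + 1 - 2 * real j) \<le> 1 / w"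
      by (intro divide_left_mono mult_pos_pos) (auto simp: w_def elim: order.strict_trans2[rotated])
  qed auto
  also have "\<dots> = ennreal (?M / w)" by (simp add: ennreal_mult[symmetric] w_def)
  finally have "measure gauss {X :: real^'m^'l. \<exists>v. norm v = 1 \<and> norm (X *v B v) \<le> sqrt A} \<le> ?M / w / z"
  proof (rule measure_gauss_le)
    have "exp (- (real p * ln A)) = (1 / sqrt A) ^ (2 * p)"
      using A by (simp add: exp_minus exp_of_nat_mult power_mult power_one_over inverse_eq_divide)
    then show "z \<le> (1 / sqrt A) ^ (2 * p) * (fact (2 * p) / (2 ^ p * fact p))"
      unfolding z_def using fact_double_ratio_ge[of p] A by (simp only:) (intro mult_left_mono zero_le_power, auto)
  qed (simp_all add: z_def w_def)
  also have "\<dots> = exp ((((N + 2 * real p) * ln (N + 2 * real p) - N * ln N - 2 * real p)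
      - ((2 * real p) * ln (2 * real p) - 2 * real p)
      - (d * ln d - (d - 2 * real p) * ln (d - 2 * real p) - 2 * real p) + (2 * real p) * ln A) / 2)"
    unfolding z_def w_def exp_add[symmetric] exp_diff[symmetric] by (simp add: field_simps)
  also have "\<dots> \<le> exp (- (s - r)\<^sup>2 / 8)"
    using exponent(1) unfolding N by simp
  finally show ?thesis by (simp add: A_def)
qed

section \<open>QR factors and singular values\<close>

lemma transpose_mult_self_nth: "(transpose Q ** Q) $ i $ j = column i Q \<bullet> column j (Q :: real^'n^'m)"
  by (simp add: matrix_matrix_mult_def transpose_def column_def inner_vec_def)

lemma norm_mult_orthonormal:
  fixes Q :: "real^'n^'m"
  assumes "transpose Q ** Q = mat 1"
  shows "norm (Q *v x) = norm x"
proof -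
  have "(Q *v x) \<bullet> (Q *v x) = ((Q *v x) v* Q) \<bullet> x" by (rule dot_lmul_matrix[symmetric])
  also have "(Q *v x) v* Q = transpose Q *v (Q *v x)" by (rule transpose_matrix_vector[symmetric])
  also have "(transpose Q *v (Q *v x)) \<bullet> x = x \<bullet> x" by (simp add: matrix_vector_mul_assoc assms)
  finally show ?thesis by (simp add: norm_eq)
qed

text \<open>Gram-Schmidt: \<open>z j\<close> is the part of column \<open>j\<close> orthogonal to
  the span \<open>W j\<close> of the earlier columns, nonzero because injectivity keeps column
  \<open>j\<close> outside \<open>W j\<close>. Below the diagonal \<open>q i \<bullet> a j\<close>
  vanishes since \<open>a j\<close> lies in \<open>W i\<close>.\<close>

lemma qr_exists:
  fixes B :: "real^('n::{finite,wellorder})^'l"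
  assumes inj: "inj ((*v) B)"
  shows "\<exists>R. upper_triangular R \<and> (\<forall>i. R $ i $ i > 0) \<and> (\<exists>Q :: ((real, 'n) vec, 'l) vec. transpose Q ** Q = mat 1 \<and> B = Q ** R)"
proof -
  define a where "a = (\<lambda>j. column j B)"
  define W where "W = (\<lambda>j. span (a ` {..<j}))"
  have "\<exists>y z. y \<in> W j \<and> (\<forall>w\<in>W j. orthogonal z w) \<and> a j = y + z" for j
    using orthogonal_subspace_decomp_exists[of "a ` {..<j}" "a j"] unfolding W_def by metis
  then obtain y z where y: "\<And>j. y j \<in> W j" and z: "\<And>j w. w \<in> W j \<Longrightarrow> orthogonal (z j) w" and yz: "\<And>j. a j = y j + z j"
    by metis
  have aW: "a i \<in> W j" if "i < j" for i j using that by (auto simp: W_def intro: span_base)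
  have "W i \<subseteq> W j" if "i < j" for i j unfolding W_def using that by (intro span_mono) auto
  then have zW: "z i \<in> W j" if "i < j" for i j
    using that y[of i] aW[OF that] yz[of i] unfolding W_def by (metis add_diff_cancel_left' span_diff subsetD)
  have a_notin: "a j \<notin> W j" for j
  proof
    assume "a j \<in> W j"
    moreover have "W j = (*v) B ` span ((\<lambda>i. axis i 1) ` {..<j})"
      unfolding W_def a_def
      by (subst linear_span_image[symmetric]) (auto simp: image_image matrix_vector_mult_basis)
    ultimately have "(axis j 1 :: (real, 'n) vec) \<in> span ((\<lambda>i. axis i 1) ` {..<j})"
      using inj by (auto simp: a_def matrix_vector_mult_basis[symmetric] dest: injD)
    moreover have "span ((\<lambda>i. axis i 1 :: (real, 'n) vec) ` {..<j}) \<subseteq> {v. v $ j = 0}"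
      by (rule span_minimal) (auto simp: axis_def subspace_def)
    ultimately show False by (auto simp: axis_def)
  qed
  have z0: "z j \<noteq> 0" for j using a_notin[of j] y[of j] yz[of j] by auto
  define q where "q = (\<lambda>j. z j /\<^sub>R norm (z j))"
  have qq: "q i \<bullet> q j = (if i = j then 1 else 0)" for i j
  proof -
    have "orthogonal (z i) (z j)" if "i \<noteq> j"
      using z zW that by (metis linorder_neqE orthogonal_commute)
    then show ?thesis using z0 by (auto simp: q_def orthogonal_def dot_square_norm power2_eq_square divide_simps)
  qed
  have nq: "norm (q i) = 1" for i using qq[of i i] by (simp add: norm_eq_1)
  have injq: "inj q"
  proof (rule injI)
    fix i j assume "q i = q j"
    then show "i = j" using qq[of i j] qq[of j j] by (auto split: if_splits)
  qed
  have a_span: "a j \<in> span (range q)" for j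
  proof (induction j rule: less_induct)
    case (less j)
    then have "W j \<subseteq> span (range q)" unfolding W_def by (intro span_minimal) auto
    moreover have "z j = norm (z j) *\<^sub>R q j" using z0 by (simp add: q_def)
    then have "z j \<in> span (range q)" by (metis rangeI span_base span_scale)
    ultimately show ?case unfolding yz[of j] using y[of j] by (intro span_add) auto
  qed
  define Q :: "((real, 'n) vec, 'l) vec" where "Q = (\<chi> k j. q j $ k)"
  define R :: "((real, 'n) vec, 'n) vec" where "R = (\<chi> i j. q i \<bullet> a j)"
  have colQ: "column j Q = q j" for j by (simp add: column_def Q_def)
  have "upper_triangular R"
    unfolding upper_triangular_def
  proof (intro allI impI)
    fix i j :: 'n assume "j < i"
    then have "orthogonal (z i) (a j)" by (intro z aW)
    then show "R $ i $ j = 0" by (simp add: R_def q_def orthogonal_def)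
  qed
  moreover have "R $ i $ i > 0" for i
  proof -
    have "z i \<bullet> a i = z i \<bullet> z i"
      using z[OF y[of i]] by (simp add: yz inner_add_right orthogonal_def)
    then show ?thesis using z0[of i] by (simp add: R_def q_def)
  qed
  moreover have "transpose Q ** Q = mat 1"
    by (simp add: vec_eq_iff transpose_mult_self_nth colQ qq mat_def)
  moreover have "B = Q ** R"
  proof -
    have "a j = (\<Sum>i\<in>UNIV. (a j \<bullet> q i) *\<^sub>R q i)" for j
    proof -
      have "a j = (\<Sum>b\<in>range q. (a j \<bullet> b) *\<^sub>R b)"
        by (rule orthonormal_expansion[OF _ _ a_span])
          (auto simp: pairwise_def orthogonal_def qq nq split: if_splits)
      then show ?thesis by (simp add: sum.reindex[OF injq])
    qed
    then have "B $ k $ j = (\<Sum>i\<in>UNIV. (a j \<bullet> q i) *\<^sub>R q i) $ k" for k j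
      by (metis a_def column_def vec_lambda_beta)
    then show ?thesis
      by (simp add: vec_eq_iff matrix_matrix_mult_def Q_def R_def inner_commute mult.commute)
  qed
  ultimately show ?thesis by blast
qed

text \<open>Uniqueness of the Cholesky factor by induction on rows: row \<open>i\<close> of the Gram
  matrix involves only rows up to \<open>i\<close>, the earlier ones cancel, the diagonal entry
  follows by positivity and the rest by division.\<close>

lemma upper_triangular_gram_unique:
  fixes R R' :: "real^('n::{finite,wellorder})^('n::{finite,wellorder})"
  assumes "upper_triangular R" "\<And>i. R $ i $ i > 0" "upper_triangular R'" "\<And>i. R' $ i $ i > 0"
    and gram: "transpose R ** R = transpose R' ** R'"
  shows "R = R'"
proof -
  have gram_nth: "(transpose R ** R) $ i $ j = (\<Sum>k\<in>{..<i}. R $ k $ i * R $ k $ j) + R $ i $ i * R $ i $ j"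
    if "upper_triangular R" for R :: "((real, 'n) vec, 'n) vec" and i j
  proof -
    have "(transpose R ** R) $ i $ j = (\<Sum>k\<in>UNIV. R $ k $ i * R $ k $ j)"
      by (simp add: matrix_matrix_mult_def transpose_def)
    also have "\<dots> = (\<Sum>k\<in>{..i}. R $ k $ i * R $ k $ j)"
      using that by (intro sum.mono_neutral_right) (auto simp: upper_triangular_def)
    also have "{..i} = insert i {..<i}" by auto
    finally show ?thesis by simp
  qed
  have "\<forall>j. R $ i $ j = R' $ i $ j" for i
  proof (induction i rule: less_induct)
    case (less i)
    then have eq: "R $ i $ i * R $ i $ j = R' $ i $ i * R' $ i $ j" for j
      using gram_nth[OF assms(1), of i j] gram_nth[OF assms(3), of i j] gram by simp
    have "(R $ i $ i)\<^sup>2 = (R' $ i $ i)\<^sup>2" using eq[of i] by (simp add: power2_eq_square)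
    then have "R $ i $ i = R' $ i $ i" using assms(2,4)[of i] by (simp add: power2_eq_iff_nonneg less_imp_le)
    then show ?case using eq assms(2)[of i] assms(4)[of i] by (auto simp: less_imp_neq)
  qed
  then show ?thesis by (simp add: vec_eq_iff)
qed

text \<open>Every admissible \<open>R\<close> has the Gram matrix of \<open>B\<close>, because
  \<open>Q\<close> has orthonormal columns; so the description in \<open>qr_R\<close> is
  unique.\<close>

lemma qr_R_spec:
  fixes B :: "real^('n::{finite,wellorder})^'l"
  assumes inj: "inj ((*v) B)"
  shows "upper_triangular (qr_R B) \<and> (\<forall>i. qr_R B $ i $ i > 0) \<and> (\<exists>Q :: ((real, 'n) vec, 'l) vec. transpose Q ** Q = mat 1 \<and> B = Q ** qr_R B)"
  unfolding qr_R_def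
proof (rule theI')
  have gram: "transpose R ** R = transpose B ** B" if "transpose Q ** Q = mat 1" "B = Q ** R" for Q :: "((real, 'n) vec, 'l) vec" and R
  proof -
    have "transpose B ** B = transpose R ** ((transpose Q ** Q) ** R)"
      by (simp only: that(2) matrix_transpose_mul matrix_mul_assoc)
    then show ?thesis by (simp add: that(1))
  qed
  show "\<exists>!R. upper_triangular R \<and> (\<forall>i. R $ i $ i > 0) \<and> (\<exists>Q :: ((real, 'n) vec, 'l) vec. transpose Q ** Q = mat 1 \<and> B = Q ** R)"
    by (rule ex_ex1I[OF qr_exists[OF inj]]) (metis gram upper_triangular_gram_unique)
qed

section \<open>Extreme singular values as extremal gains on the unit sphere\<close>

lemma linear_coeff_zero_of_quadratic_nonneg:
  fixes c d :: real
  assumes "\<And>t. 0 \<le> 2 * t * c + t\<^sup>2 * d"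
  shows "c = 0"
proof -
  \<comment> \<open>At \<open>t = - c / e\<close> the expression is
    \<open>(c / e)\<^sup>2 * (d - 2 * e)\<close>, so any positive \<open>e\<close> with
    \<open>d < 2 * e\<close> forces \<open>c = 0\<close>.\<close>
  define e where "e = \<bar>d\<bar> + 1"
  have e: "e > 0" "d - 2 * e < 0" by (auto simp: e_def)
  have "0 \<le> 2 * (- c / e) * c + (- c / e)\<^sup>2 * d" by (rule assms)
  also have "\<dots> = (c / e)\<^sup>2 * (d - 2 * e)" using e by (simp add: field_simps power2_eq_square)
  finally have "(c / e)\<^sup>2 \<le> 0" using e by (simp add: zero_le_mult_iff)
  then show ?thesis using e by simp
qed

text \<open>The form \<open>\<epsilon> * (\<mu> * (u \<bullet> u) - (X *v u) \<bullet> (X *v u))\<close> is semidefinite and vanishes at \<open>v\<close>, hence \<open>v\<close>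
  lies in its kernel. The sign \<open>\<epsilon>\<close> covers maxima and minima at once.\<close>
lemma gram_eigenvector_of_extremal:
  fixes X :: "real^'n^'m"
  assumes \<epsilon>: "\<epsilon> \<noteq> 0" and ge: "\<And>u. 0 \<le> \<epsilon> * (\<mu> * (u \<bullet> u) - (X *v u) \<bullet> (X *v u))"
    and eq: "\<mu> * (v \<bullet> v) = (X *v v) \<bullet> (X *v v)"
  shows "(transpose X ** X) *v v = \<mu> *\<^sub>R v"
proof -
  have gram: "((transpose X ** X) *v v) \<bullet> u = (X *v v) \<bullet> (X *v u)" for u
  proof -
    have "(transpose X ** X) *v v = (X *v v) v* X"
      by (simp add: matrix_vector_mul_assoc[symmetric] transpose_matrix_vector)
    then show ?thesis by (simp add: dot_lmul_matrix)
  qed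
  have "\<mu> * (v \<bullet> u) - (X *v v) \<bullet> (X *v u) = 0" for u
  proof -
    have "\<epsilon> * (\<mu> * (v \<bullet> u) - (X *v v) \<bullet> (X *v u)) = 0"
    proof (rule linear_coeff_zero_of_quadratic_nonneg)
      fix t :: real
      have "0 \<le> \<epsilon> * (\<mu> * ((v + t *\<^sub>R u) \<bullet> (v + t *\<^sub>R u)) - (X *v (v + t *\<^sub>R u)) \<bullet> (X *v (v + t *\<^sub>R u)))"
        by (rule ge)
      also have "(v + t *\<^sub>R u) \<bullet> (v + t *\<^sub>R u) = v \<bullet> v + 2 * t * (v \<bullet> u) + t\<^sup>2 * (u \<bullet> u)"
        by (simp add: inner_add_left inner_add_right inner_commute[of u v] power2_eq_square algebra_simps)
      also have "(X *v (v + t *\<^sub>R u)) \<bullet> (X *v (v + t *\<^sub>R u))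
          = (X *v v) \<bullet> (X *v v) + 2 * t * ((X *v v) \<bullet> (X *v u)) + t\<^sup>2 * ((X *v u) \<bullet> (X *v u))"
        by (simp add: matrix_vector_right_distrib matrix_vector_mult_scaleR inner_add_left inner_add_right
            inner_commute[of "X *v u" "X *v v"] power2_eq_square algebra_simps)
      finally have "0 \<le> \<epsilon> * (\<mu> * (v \<bullet> v + 2 * t * (v \<bullet> u) + t\<^sup>2 * (u \<bullet> u))
        - (\<mu> * (v \<bullet> v) + 2 * t * ((X *v v) \<bullet> (X *v u)) + t\<^sup>2 * ((X *v u) \<bullet> (X *v u))))" unfolding eq .
      then show "0 \<le> 2 * t * (\<epsilon> * (\<mu> * (v \<bullet> u) - (X *v v) \<bullet> (X *v u))) + t\<^sup>2 * (\<epsilon> * (\<mu> * (u \<bullet> u) - (X *v u) \<bullet> (X *v u)))"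
        by (simp add: algebra_simps)
    qed
    then show ?thesis using \<epsilon> by simp
  qed
  then have "((transpose X ** X) *v v - \<mu> *\<^sub>R v) \<bullet> u = 0" for u
    by (simp add: inner_diff_left gram)
  then have "(transpose X ** X) *v v - \<mu> *\<^sub>R v = 0" by (metis inner_eq_zero_iff)
  then show ?thesis by simp
qed

lemma gram_eigenvector_norm:
  fixes X :: "real^'n^'m"
  assumes "(transpose X ** X) *v v = \<mu> *\<^sub>R v"
  shows "(X *v v) \<bullet> (X *v u) = \<mu> * (v \<bullet> u)"
proof -
  have "(X *v v) v* X = \<mu> *\<^sub>R v"
    using assms by (simp add: matrix_vector_mul_assoc[symmetric] transpose_matrix_vector)
  then show ?thesis by (simp add: dot_lmul_matrix[symmetric])
qed

text \<open>\<open>Max\<close> and \<open>Min\<close> in \<open>cond\<close> are meaningful only for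
  finite sets. Eigenvectors of the Gram matrix for distinct eigenvalues are orthogonal, and a set of
  pairwise orthogonal vectors is finite.\<close>

lemma finite_sing_vals: "finite (sing_vals (X :: real^'n^'m))"
proof -
  define E where "E = {\<mu>. \<exists>v. v \<noteq> 0 \<and> (transpose X ** X) *v v = \<mu> *\<^sub>R v}"
  have "\<forall>\<mu>\<in>E. \<exists>v. v \<noteq> 0 \<and> (transpose X ** X) *v v = \<mu> *\<^sub>R v" by (auto simp: E_def)
  then obtain e where e: "\<And>\<mu>. \<mu> \<in> E \<Longrightarrow> e \<mu> \<noteq> 0" "\<And>\<mu>. \<mu> \<in> E \<Longrightarrow> (transpose X ** X) *v e \<mu> = \<mu> *\<^sub>R e \<mu>" by metis
  have orth: "e \<mu> \<bullet> e \<nu> = 0" if "\<mu> \<in> E" "\<nu> \<in> E" "\<mu> \<noteq> \<nu>" for \<mu> \<nu>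
  proof -
    have "\<mu> * (e \<mu> \<bullet> e \<nu>) = \<nu> * (e \<mu> \<bullet> e \<nu>)"
      using gram_eigenvector_norm[OF e(2)[OF that(1)], of "e \<nu>"] gram_eigenvector_norm[OF e(2)[OF that(2)], of "e \<mu>"]
      by (simp add: inner_commute)
    then show ?thesis using that by simp
  qed
  have "pairwise orthogonal (e ` E)"
    unfolding pairwise_def orthogonal_def using orth by fastforce
  then have "finite (e ` E)" by (rule pairwise_orthogonal_imp_finite)
  moreover have "inj_on e E"
    using orth e(1) by (intro inj_onI) (metis inner_eq_zero_iff)
  ultimately have "finite E" by (rule finite_imageD)
  then have "finite (sqrt ` E)" by simp
  moreover have "sing_vals X = sqrt ` E" by (auto simp: sing_vals_def E_def)
  ultimately show ?thesis by simp
qed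

lemma sing_vals_norm:
  assumes "\<sigma> \<in> sing_vals (X :: real^'n^'m)"
  obtains v where "norm v = 1" "norm (X *v v) = \<sigma>"
proof -
  obtain \<mu> v where v: "\<sigma> = sqrt \<mu>" "v \<noteq> 0" "(transpose X ** X) *v v = \<mu> *\<^sub>R v"
    using assms by (auto simp: sing_vals_def)
  have "(norm (X *v v))\<^sup>2 = \<mu> * (norm v)\<^sup>2"
    using gram_eigenvector_norm[OF v(3), of v] by (simp add: dot_square_norm)
  then have "\<mu> = (norm (X *v v) / norm v)\<^sup>2" using v(2) by (simp add: power_divide)
  then have "\<sigma> = norm (X *v v) / norm v" using v(1) by simp
  then have "norm (X *v (v /\<^sub>R norm v)) = \<sigma>" by (simp add: matrix_vector_mult_scaleR divide_inverse mult.commute)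
  moreover have "norm (v /\<^sub>R norm v) = 1" using v(2) by simp
  ultimately show thesis using that by blast
qed

lemma extremal_norm_in_sing_vals:
  fixes X :: "real^'n^'m"
  assumes "\<epsilon> \<noteq> 0" and v: "norm v = 1" and ext: "\<And>u. norm u = 1 \<Longrightarrow> 0 \<le> \<epsilon> * ((norm (X *v v))\<^sup>2 - (norm (X *v u))\<^sup>2)"
  shows "norm (X *v v) \<in> sing_vals X"
proof -
  have "(transpose X ** X) *v v = (norm (X *v v))\<^sup>2 *\<^sub>R v"
  proof (rule gram_eigenvector_of_extremal[OF assms(1)])
    fix u
    show "0 \<le> \<epsilon> * ((norm (X *v v))\<^sup>2 * (u \<bullet> u) - (X *v u) \<bullet> (X *v u))"
    proof (cases "u = 0")
      case False
      have "0 \<le> \<epsilon> * ((norm (X *v v))\<^sup>2 - (norm (X *v (u /\<^sub>R norm u)))\<^sup>2)"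
        using False by (intro ext) simp
      then have "0 \<le> (norm u)\<^sup>2 * (\<epsilon> * ((norm (X *v v))\<^sup>2 - (norm (X *v (u /\<^sub>R norm u)))\<^sup>2))"
        by (rule mult_nonneg_nonneg[OF zero_le_power2])
      also have "\<dots> = \<epsilon> * ((norm (X *v v))\<^sup>2 * (u \<bullet> u) - (X *v u) \<bullet> (X *v u))"
        using False by (simp add: matrix_vector_mult_scaleR dot_square_norm power_mult_distrib divide_simps power_divide)
      finally show ?thesis .
    qed simp
  qed (use v in \<open>simp add: dot_square_norm\<close>)
  moreover have "v \<noteq> 0" using v by auto
  moreover have "norm (X *v v) = sqrt ((norm (X *v v))\<^sup>2)" by simp
  ultimately show ?thesis unfolding sing_vals_def by blast
qed

lemma Max_Min_sing_vals:
  fixes X :: "real^'n^'m"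
  shows "\<exists>v. norm v = 1 \<and> norm (X *v v) = Max (sing_vals X)"
    and "\<exists>v. norm v = 1 \<and> norm (X *v v) = Min (sing_vals X)"
    and "norm u = 1 \<Longrightarrow> norm (X *v u) \<le> Max (sing_vals X)"
    and "norm u = 1 \<Longrightarrow> Min (sing_vals X) \<le> norm (X *v u)"
proof -
  have cont: "continuous_on (sphere 0 1) (\<lambda>v. norm (X *v v))" by (intro continuous_intros)
  have ne: "sphere (0::real^'n) 1 \<noteq> {}" by simp
  obtain v1 where v1: "norm v1 = 1" "\<And>u. norm u = 1 \<Longrightarrow> norm (X *v u) \<le> norm (X *v v1)"
    using continuous_attains_sup[OF compact_sphere ne cont] by auto
  obtain v2 where v2: "norm v2 = 1" "\<And>u. norm u = 1 \<Longrightarrow> norm (X *v v2) \<le> norm (X *v u)"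
    using continuous_attains_inf[OF compact_sphere ne cont] by auto
  have "norm (X *v v1) \<in> sing_vals X"
    by (rule extremal_norm_in_sing_vals[of 1]) (use v1 in \<open>auto intro!: power_mono\<close>)
  then have max: "Max (sing_vals X) = norm (X *v v1)"
    by (intro Max_eqI finite_sing_vals) (metis sing_vals_norm v1(2))
  have "norm (X *v v2) \<in> sing_vals X"
    by (rule extremal_norm_in_sing_vals[of "-1"]) (use v2 in \<open>auto intro!: power_mono\<close>)
  then have min: "Min (sing_vals X) = norm (X *v v2)"
    by (intro Min_eqI finite_sing_vals) (metis sing_vals_norm v2(2))
  show "\<exists>v. norm v = 1 \<and> norm (X *v v) = Max (sing_vals X)"
    and "\<exists>v. norm v = 1 \<and> norm (X *v v) = Min (sing_vals X)"
    and "norm u = 1 \<Longrightarrow> norm (X *v u) \<le> Max (sing_vals X)"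
    and "norm u = 1 \<Longrightarrow> Min (sing_vals X) \<le> norm (X *v u)"
    unfolding max min using v1 v2 by auto
qed

lemma inj_invertible_square:
  fixes R :: "real^'n^'n"
  assumes "\<And>z. R *v z = 0 \<Longrightarrow> z = 0"
  shows "R ** matrix_inv R = mat 1" "matrix_inv R ** R = mat 1"
proof -
  have "inj ((*v) R)" using assms by (simp add: linear_injective_0)
  then have "invertible R"
    by (simp add: invertible_left_inverse matrix_left_invertible_injective)
  then have "R ** matrix_inv R = mat 1 \<and> matrix_inv R ** R = mat 1"
    unfolding matrix_inv_def invertible_def by (rule someI_ex)
  then show "R ** matrix_inv R = mat 1" "matrix_inv R ** R = mat 1" by auto
qed

text \<open>Up to the isometry \<open>B\<close>, the singular values of \<open>A ** matrix_inv R\<close> are the inverses of the gains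
  \<open>norm (W *v B u)\<close> at extremal unit vectors \<open>u\<close>.\<close>
lemma sketch_cond_ge_iff:
  fixes A :: "real^('n::{finite,wellorder})^'m" and W :: "real^'m^'l" and B :: "(real, 'n) vec \<Rightarrow> real^'m"
  assumes A: "inj ((*v) A)" and B: "linear B" "\<And>v. norm (B v) = norm v" and range: "range B = range ((*v) A)"
    and c: "c > 0"
  shows "ereal c \<le> sketch_cond A W \<longleftrightarrow>
    (\<exists>u1 u2. norm u1 = 1 \<and> norm u2 = 1 \<and> c * norm (W *v B u1) \<le> norm (W *v B u2))"
proof (cases "inj ((*v) (W ** A))")
  case False
  \<comment> \<open>A kernel vector of \<open>W ** A\<close> yields a unit vector \<open>u\<close>
    with gain 0, and \<open>u1 = u2 = u\<close> then matches the value \<infinity> of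
    \<open>sketch_cond\<close>.\<close>
  then obtain z where z: "(W ** A) *v z = 0" "z \<noteq> 0" by (auto simp: linear_injective_0)
  obtain u where u: "B u = A *v z" using range by (metis rangeE rangeI)
  have "A *v z \<noteq> 0" using A z(2) by (auto simp: linear_injective_0)
  then have "norm u \<noteq> 0" using u B(2)[of u] by auto
  moreover have "W *v B u = 0" using z(1) by (simp add: u matrix_vector_mul_assoc)
  ultimately have "norm (u /\<^sub>R norm u) = 1" "c * norm (W *v B (u /\<^sub>R norm u)) \<le> norm (W *v B (u /\<^sub>R norm u))"
    by (simp_all add: linear_scale[OF B(1)] matrix_vector_mult_scaleR)
  then have "\<exists>u1 u2. norm u1 = 1 \<and> norm u2 = 1 \<and> c * norm (W *v B u1) \<le> norm (W *v B u2)"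
    by blast
  moreover have "sketch_cond A W = \<infinity>" using False by (simp add: sketch_cond_def full_rank_injective)
  ultimately show ?thesis by simp
next
  case True
  define R where "R = qr_R (W ** A)"
  define X where "X = A ** matrix_inv R"
  obtain Q :: "((real, 'n) vec, 'l) vec" where Q: "transpose Q ** Q = mat 1" "W ** A = Q ** R"
    using qr_R_spec[OF True] by (auto simp: R_def)
  have normR: "norm (R *v z) = norm (W *v (A *v z))" for z
    by (metis Q norm_mult_orthonormal matrix_vector_mul_assoc)
  have "z = 0" if "R *v z = 0" for z
    using that normR[of z] True by (auto simp: linear_injective_0 matrix_vector_mul_assoc)
  note R_inv = inj_invertible_square[OF this]
  \<comment> \<open>\<open>W ** X\<close> is an isometry, since \<open>R\<close> and
    \<open>W ** A\<close> have the same norms. Hence normalising \<open>X *v x\<close> for a unit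
    vector \<open>x\<close> produces a vector of gain \<open>1 / norm (X *v x)\<close>, which
    interchanges the roles of largest and smallest.\<close>
  have normX: "norm (W *v (X *v x)) = norm x" for x
  proof -
    have "norm (W *v (X *v x)) = norm (R *v (matrix_inv R *v x))"
      by (simp add: X_def normR matrix_vector_mul_assoc[symmetric])
    then show ?thesis by (simp add: matrix_vector_mul_assoc R_inv)
  qed
  have X0: "X *v x \<noteq> 0" if "x \<noteq> 0" for x using normX[of x] that by auto
  have to_X: "\<exists>x. X *v x = B u" for u
  proof -
    obtain z where "B u = A *v z" using range by (metis rangeE rangeI)
    then have "X *v (R *v z) = B u"
      by (simp add: X_def matrix_vector_mul_assoc matrix_mul_assoc[symmetric] R_inv)
    then show ?thesis by blast
  qed
  have to_B: "\<exists>u. norm u = 1 \<and> norm (W *v B u) = 1 / norm (X *v x)" if "norm x = 1" for x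
  proof -
    obtain u where u: "B u = X *v x" using range unfolding X_def by (metis matrix_vector_mul_assoc rangeE rangeI)
    have "x \<noteq> 0" using that by force
    then have "norm (X *v x) > 0" using X0 by simp
    moreover have "norm u = norm (X *v x)" using B(2)[of u] by (simp add: u)
    ultimately have "norm (u /\<^sub>R norm (X *v x)) = 1" by simp
    moreover have "norm (W *v B (u /\<^sub>R norm (X *v x))) = 1 / norm (X *v x)"
      by (simp add: linear_scale[OF B(1)] matrix_vector_mult_scaleR u normX that divide_inverse)
    ultimately show ?thesis by blast
  qed
  define \<sigma>1 \<sigma>2 where "\<sigma>1 = Max (sing_vals X)" and "\<sigma>2 = Min (sing_vals X)"
  obtain v1 v2 where v: "norm v1 = 1" "norm (X *v v1) = \<sigma>1" "norm v2 = 1" "norm (X *v v2) = \<sigma>2"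
    using Max_Min_sing_vals(1,2)[of X] unfolding \<sigma>1_def \<sigma>2_def by blast
  have pos: "\<sigma>1 > 0" "\<sigma>2 > 0" using v X0[of v1] X0[of v2] by (metis norm_zero zero_less_norm_iff zero_neq_one)+
  have bounds: "\<sigma>2 * norm x \<le> norm (X *v x)" "norm (X *v x) \<le> \<sigma>1 * norm x" for x
  proof -
    have "norm (X *v (x /\<^sub>R norm x)) \<le> \<sigma>1 \<and> \<sigma>2 \<le> norm (X *v (x /\<^sub>R norm x))" if "x \<noteq> 0"
      unfolding \<sigma>1_def \<sigma>2_def using that by (intro conjI Max_Min_sing_vals(3,4)) auto
    then have "norm (X *v x) / norm x \<le> \<sigma>1 \<and> \<sigma>2 \<le> norm (X *v x) / norm x" if "x \<noteq> 0"
      using that by (simp add: matrix_vector_mult_scaleR divide_inverse mult.commute)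
    then show "\<sigma>2 * norm x \<le> norm (X *v x)" "norm (X *v x) \<le> \<sigma>1 * norm x"
      by (cases "x = 0"; simp add: field_simps)+
  qed
  have "sketch_cond A W = ereal (\<sigma>1 / \<sigma>2)"
    using True by (simp add: sketch_cond_def full_rank_injective cond_def X_def R_def \<sigma>1_def \<sigma>2_def)
  moreover have "c \<le> \<sigma>1 / \<sigma>2 \<longleftrightarrow> (\<exists>u1 u2. norm u1 = 1 \<and> norm u2 = 1 \<and> c * norm (W *v B u1) \<le> norm (W *v B u2))"
  proof
    assume le: "c \<le> \<sigma>1 / \<sigma>2"
    obtain u1 u2 where "norm u1 = 1" "norm (W *v B u1) = 1 / \<sigma>1" "norm u2 = 1" "norm (W *v B u2) = 1 / \<sigma>2"
      using to_B[OF v(1)] to_B[OF v(3)] v by auto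
    moreover have "c * (1 / \<sigma>1) \<le> 1 / \<sigma>2" using le pos by (simp add: field_simps)
    ultimately show "\<exists>u1 u2. norm u1 = 1 \<and> norm u2 = 1 \<and> c * norm (W *v B u1) \<le> norm (W *v B u2)"
      by metis
  next
    assume "\<exists>u1 u2. norm u1 = 1 \<and> norm u2 = 1 \<and> c * norm (W *v B u1) \<le> norm (W *v B u2)"
    then obtain u1 u2 where u: "norm u1 = 1" "norm u2 = 1" "c * norm (W *v B u1) \<le> norm (W *v B u2)" by blast
    obtain x1 x2 where x: "X *v x1 = B u1" "X *v x2 = B u2" using to_X by metis
    have "c * norm x1 \<le> norm x2" using u(3) normX[of x1] normX[of x2] by (simp add: x)
    moreover have "1 \<le> \<sigma>1 * norm x1" "\<sigma>2 * norm x2 \<le> 1"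
      using bounds(2)[of x1] bounds(1)[of x2] u by (simp_all add: x B(2))
    ultimately have "\<sigma>2 * (c * norm x1) \<le> 1"
      using pos by (meson mult_left_mono less_imp_le order.trans)
    then have "\<sigma>1 * (\<sigma>2 * (c * norm x1)) \<le> \<sigma>1 * 1" using pos by (intro mult_left_mono) auto
    then have "c * \<sigma>2 * (\<sigma>1 * norm x1) \<le> \<sigma>1" by (simp only: mult_ac mult_1_right)
    moreover have "c * \<sigma>2 * 1 \<le> c * \<sigma>2 * (\<sigma>1 * norm x1)"
      using \<open>1 \<le> \<sigma>1 * norm x1\<close> pos c by (intro mult_left_mono) auto
    ultimately have "c * \<sigma>2 \<le> \<sigma>1" by linarith
    then show "c \<le> \<sigma>1 / \<sigma>2" using pos by (simp add: pos_le_divide_eq)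
  qed
  ultimately show ?thesis by simp
qed

lemma closed_gain_ratio:
  fixes B :: "real^'n \<Rightarrow> real^'m"
  assumes B: "linear B"
  shows "closed {W :: real^'m^'l. \<exists>u1 u2. norm u1 = 1 \<and> norm u2 = 1 \<and> c * norm (W *v B u1) \<le> norm (W *v B u2)}"
proof -
  have contB: "continuous_on UNIV B" using B(1) by (simp add: linear_continuous_on linear_linear)
  note [continuous_intros] = continuous_on_compose2[OF contB]
  have "closed {p :: ((real^'n) \<times> (real^'n)) \<times> (real^'m^'l). c * norm (snd p *v B (fst (fst p))) \<le> norm (snd p *v B (snd (fst p)))}"
    by (intro closed_Collect_le continuous_intros) auto
  from closed_compact_existential[OF compact_Times[OF compact_sphere[of 0 1] compact_sphere[of 0 1]] this]
  show ?thesis by (simp add: Bex_def conj_assoc)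
qed

section \<open>The condition number of the sketched matrix\<close>

lemma bij_betw_axis_Basis:
  "bij_betw (\<lambda>(i, j). axis i (axis j 1)) (UNIV :: ('l \<times> 'm) set) (Basis :: (real^'m^'l) set)"
  unfolding bij_betw_def
  by (auto simp: inj_on_def axis_eq_axis Basis_vec_def)

lemma inner_axis_axis_nth: "(x :: real^'m^'l) \<bullet> axis i (axis j 1) = x $ i $ j"
  by (simp add: inner_axis)

lemma emeasure_gauss_box:
  "emeasure gauss (box a b) = (\<Prod>u\<in>Basis. emeasure (density lborel std_normal_density) {a \<bullet> u<..<b \<bullet> u})"
proof -
  have "emeasure gauss (box a b) = (\<integral>\<^sup>+x. (\<Prod>u\<in>Basis. indicator {a \<bullet> u<..<b \<bullet> u} (x \<bullet> u)) \<partial>gauss)"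
  proof -
    have "indicator (box a b) x = (\<Prod>u\<in>Basis. indicator {a \<bullet> u<..<b \<bullet> u} (x \<bullet> u) :: ennreal)" for x
      by (auto simp: indicator_def mem_box)
    then show ?thesis by (simp flip: nn_integral_indicator)
  qed
  also have "\<dots> = (\<Prod>u\<in>Basis. \<integral>\<^sup>+t. indicator {a \<bullet> u<..<b \<bullet> u} t \<partial>density lborel std_normal_density)"
    by (rule nn_integral_gauss_prod) simp
  finally show ?thesis by simp
qed

text \<open>Open boxes generate the Borel sets and are stable under intersection, so agreement on
  boxes suffices. The preimage of a box is an intersection of one event per entry, to which
  independence applies.\<close>

lemma distr_std_normal_matrix:
  fixes \<Omega> :: "'s \<Rightarrow> real^'m^'l"
  assumes "prob_space M"
    and dist: "\<And>i j. distributed M lborel (\<lambda>\<omega>. \<Omega> \<omega> $ i $ j) std_normal_density"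
    and indep: "prob_space.indep_vars M (\<lambda>_. borel) (\<lambda>(i, j) \<omega>. \<Omega> \<omega> $ i $ j) (UNIV :: ('l \<times> 'm) set)"
  shows "\<Omega> \<in> borel_measurable M" "distr M borel \<Omega> = gauss"
proof -
  interpret prob_space M by fact
  have entry: "(\<lambda>\<omega>. \<Omega> \<omega> $ i $ j) \<in> borel_measurable M" for i j
    using distributed_measurable[OF dist[of i j]] by simp
  have "(\<lambda>\<omega>. \<Omega> \<omega> \<bullet> u) \<in> borel_measurable M" if "u \<in> Basis" for u
  proof -
    obtain i j where "u = axis i (axis j 1)" using \<open>u \<in> Basis\<close> by (auto simp: Basis_vec_def)
    then show ?thesis by (simp add: inner_axis_axis_nth entry)
  qed
  then show meas [measurable]: "\<Omega> \<in> borel_measurable M"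
    by (subst borel_measurable_euclidean_space) auto
  have box: "emeasure (distr M borel \<Omega>) (box a b) = emeasure gauss (box a b)" for a b
  proof -
    define I where "I = (\<lambda>(i, j). {a $ i $ j <..< b $ i $ j})"
    have "\<Omega> -` box a b \<inter> space M = (\<Inter>k\<in>UNIV. (\<lambda>\<omega>. case k of (i, j) \<Rightarrow> \<Omega> \<omega> $ i $ j) -` I k \<inter> space M)"
      by (auto simp: mem_box I_def Basis_vec_def inner_axis_axis_nth)
    then have "emeasure (distr M borel \<Omega>) (box a b) = ennreal (prob (\<Inter>k\<in>UNIV. (\<lambda>\<omega>. case k of (i, j) \<Rightarrow> \<Omega> \<omega> $ i $ j) -` I k \<inter> space M))"
      by (simp add: emeasure_distr emeasure_eq_measure)
    also have "\<dots> = ennreal (\<Prod>k\<in>UNIV. prob ((\<lambda>\<omega>. case k of (i, j) \<Rightarrow> \<Omega> \<omega> $ i $ j) -` I k \<inter> space M))"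
      using indep_varsD[OF indep, of UNIV I] by (simp add: I_def split_beta' case_prod_beta')
    also have "\<dots> = (\<Prod>k\<in>UNIV. emeasure M ((\<lambda>\<omega>. case k of (i, j) \<Rightarrow> \<Omega> \<omega> $ i $ j) -` I k \<inter> space M))"
      by (simp add: emeasure_eq_measure prod_ennreal)
    also have "\<dots> = (\<Prod>k\<in>UNIV. emeasure (density lborel std_normal_density) (I k))"
    proof (intro prod.cong refl)
      fix k :: "'l \<times> 'm"
      obtain i j where k: "k = (i, j)" by (cases k)
      have "emeasure (distr M lborel (\<lambda>\<omega>. \<Omega> \<omega> $ i $ j)) (I k) = emeasure M ((\<lambda>\<omega>. \<Omega> \<omega> $ i $ j) -` I k \<inter> space M)"
        using entry[of i j] by (intro emeasure_distr) (auto simp: I_def k)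
      then show "emeasure M ((\<lambda>\<omega>. case k of (i, j) \<Rightarrow> \<Omega> \<omega> $ i $ j) -` I k \<inter> space M) = emeasure (density lborel std_normal_density) (I k)"
        by (simp add: k distributed_distr_eq_density[OF dist])
    qed
    also have "\<dots> = (\<Prod>k\<in>UNIV. emeasure (density lborel std_normal_density)
        {a \<bullet> (case k of (i, j) \<Rightarrow> axis i (axis j 1)) <..< b \<bullet> (case k of (i, j) \<Rightarrow> axis i (axis j 1))})"
      by (intro prod.cong refl) (auto simp: I_def inner_axis_axis_nth)
    also have "\<dots> = emeasure gauss (box a b)"
      unfolding emeasure_gauss_box by (rule prod.reindex_bij_betw[OF bij_betw_axis_Basis])
    finally show ?thesis .
  qed
  show "distr M borel \<Omega> = gauss"
  proof (rule measure_eqI_generator_eq)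
    let ?E = "range (\<lambda>(a, b). box a b :: (real^'m^'l) set)"
    show "Int_stable ?E" by (auto simp: Int_stable_def box_Int_box)
    show "?E \<subseteq> Pow UNIV" "sets (distr M borel \<Omega>) = sigma_sets UNIV ?E" "sets gauss = sigma_sets UNIV ?E"
      by (simp_all add: borel_eq_box)
    let ?A = "\<lambda>n::nat. box (- (real n *\<^sub>R One)) (real n *\<^sub>R One) :: (real^'m^'l) set"
    show "range ?A \<subseteq> ?E" "(\<Union>i. ?A i) = UNIV" unfolding UN_box_eq_UNIV by auto
    show "emeasure (distr M borel \<Omega>) (?A i) \<noteq> \<infinity>" for i
      by (simp add: emeasure_distr)
    show "emeasure (distr M borel \<Omega>) X = emeasure gauss X" if "X \<in> ?E" for X
      using that box by auto
  qed
qed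

theorem theorem3p5:
  fixes A :: "real^'n::{finite,wellorder}^'m"
    and M :: "'s measure"
    and \<Omega> :: "'s \<Rightarrow> real^'m^'l"
  assumes "prob_space M"
    and "CARD('m) \<ge> CARD('n)"
    and "rank A = CARD('n)"
    and "CARD('l) > CARD('n)"
    and "\<And>i j. distributed M lborel (\<lambda>\<omega>. \<Omega> \<omega> $ i $ j) std_normal_density"
    and "prob_space.indep_vars M (\<lambda>_. borel) (\<lambda>(i, j) \<omega>. \<Omega> \<omega> $ i $ j) (UNIV :: ('l \<times> 'm) set)"
  shows "{\<omega> \<in> space M. sketch_cond A (\<Omega> \<omega>) \<ge>
            ereal ((3 + sqrt (CARD('n) / CARD('l))) / (1 - sqrt (CARD('n) / CARD('l))))} \<in> sets M
     \<and> measure M {\<omega> \<in> space M. sketch_cond A (\<Omega> \<omega>) \<ge>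
            ereal ((3 + sqrt (CARD('n) / CARD('l))) / (1 - sqrt (CARD('n) / CARD('l))))}
        \<le> 2 * exp (- (sqrt (CARD('l)) - sqrt (CARD('n)))\<^sup>2 / 8)"
proof -
  interpret prob_space M by fact
  interpret G: prob_space "gauss :: (real^'m^'l) measure" by (rule prob_space_gauss)
  define r s where "r = sqrt CARD('n)" and "s = sqrt CARD('l)"
  define c where "c = (3 + sqrt (CARD('n) / CARD('l))) / (1 - sqrt (CARD('n) / CARD('l)))"
  have r: "r > 0" and rs: "r < s" using assms(4) by (simp_all add: r_def s_def)
  have c: "c = (3 * s + r) / (s - r)"
  proof -
    have "sqrt (CARD('n) / CARD('l)) = r / s" by (simp add: r_def s_def real_sqrt_divide)
    then have "c = (3 + r / s) / (1 - r / s)" by (simp only: c_def)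
    also have "\<dots> = (s * (3 + r / s)) / (s * (1 - r / s))" using r rs by simp
    also have "\<dots> = (3 * s + r) / (s - r)" using r rs by (simp add: distrib_left right_diff_distrib)
    finally show ?thesis .
  qed
  have cpos: "c > 0" using r rs by (simp add: c)
  note law = distr_std_normal_matrix[OF assms(1,5,6)]
  note [measurable] = law(1)
  have A: "inj ((*v) A)" using assms(3) by (simp add: full_rank_injective)
  have "dim (range ((*v) A)) = dim (UNIV :: ((real, 'n) vec) set)"
    using A by (intro dim_image_eq) (auto simp: inj_on_subset)
  then obtain B where B: "linear B" "B ` (UNIV :: ((real, 'n) vec) set) = range ((*v) A)" "\<And>v. norm (B v) = norm v"
    using isometries_subspaces[of "UNIV :: ((real, 'n) vec) set" "range ((*v) A)"]
    by (metis (no_types, lifting) UNIV_I linear_subspace_image matrix_vector_mul_linear subspace_UNIV)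
  define T where "T = {W :: real^'m^'l. \<exists>u1 u2. norm u1 = 1 \<and> norm u2 = 1 \<and> c * norm (W *v B u1) \<le> norm (W *v B u2)}"
  have T [measurable]: "T \<in> sets borel" unfolding T_def by (intro borel_closed closed_gain_ratio B(1))
  \<comment> \<open>The event is the preimage of the closed set \<open>T\<close>, which settles its
    measurability and transfers its probability to the Gaussian measure.\<close>
  have event: "{\<omega> \<in> space M. sketch_cond A (\<Omega> \<omega>) \<ge> ereal c} = \<Omega> -` T \<inter> space M"
    by (auto simp: T_def sketch_cond_ge_iff[OF A B(1,3,2) cpos])
  have "measure M (\<Omega> -` T \<inter> space M) = measure gauss T"
    unfolding law(2)[symmetric] by (simp add: measure_distr)
  moreover have "measure gauss T \<le> 2 * exp (- (s - r)\<^sup>2 / 8)"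
  proof (cases "(s - r)\<^sup>2 \<ge> 8 * ln 2")
    case False
    then have "exp (- ln 2) \<le> exp (- (s - r)\<^sup>2 / 8)" by simp
    then have "1 \<le> 2 * exp (- (s - r)\<^sup>2 / 8)" by (simp add: exp_minus)
    then show ?thesis using G.prob_le_1[of T] by linarith
  next
    case True
    define a b where "a = sqrt ((3 * s + r) * (3 * s + 4 * r) / 4)"
      and "b = sqrt ((s - r)\<^sup>2 * (3 * s + 4 * r) / (4 * (3 * s + r)))"
    define E1 where "E1 = {W :: real^'m^'l. \<exists>v. norm v = 1 \<and> a \<le> norm (W *v B v)}"
    define E2 where "E2 = {W :: real^'m^'l. \<exists>v. norm v = 1 \<and> norm (W *v B v) \<le> b}"
    \<comment> \<open>The square of \<open>a = c * b\<close>, the relation that lets the ratio event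
      be split at the level \<open>b\<close>.\<close>
    have "c\<^sup>2 * ((s - r)\<^sup>2 * (3 * s + 4 * r) / (4 * (3 * s + r))) = (3 * s + r) * (3 * s + 4 * r) / 4"
    proof -
      have "(k / D)\<^sup>2 * (D\<^sup>2 * K / (4 * k)) = k * K / 4" if "k \<noteq> 0" "D \<noteq> 0" for k D K :: real
        using that by (simp add: field_simps power2_eq_square)
      then show ?thesis unfolding c by this (use r rs in auto)
    qed
    then have "a = sqrt (c\<^sup>2 * ((s - r)\<^sup>2 * (3 * s + 4 * r) / (4 * (3 * s + r))))" by (simp only: a_def)
    then have ab: "a = c * b" using cpos unfolding b_def real_sqrt_mult by simp
    have "T \<subseteq> E1 \<union> E2"
    proof
      fix W assume "W \<in> T"
      then obtain u1 u2 where u: "norm u1 = 1" "norm u2 = 1" "c * norm (W *v B u1) \<le> norm (W *v B u2)"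
        by (auto simp: T_def)
      show "W \<in> E1 \<union> E2"
      proof (cases "norm (W *v B u1) \<le> b")
        case True
        then show ?thesis using u by (auto simp: E2_def)
      next
        case False
        then have "a \<le> norm (W *v B u2)" unfolding ab using u(3) cpos
          by (meson linorder_not_le mult_left_mono order.trans less_imp_le)
        then show ?thesis using u by (auto simp: E1_def)
      qed
    qed
    moreover have "E1 \<in> sets borel" "E2 \<in> sets borel"
      unfolding E1_def E2_def by (intro borel_closed closed_gain_ge closed_gain_le B(1))+
    ultimately have "measure gauss T \<le> measure gauss E1 + measure gauss E2"
      by (intro order.trans[OF G.finite_measure_mono measure_Un_le]) auto
    moreover have "measure gauss E1 \<le> exp (- (s - r)\<^sup>2 / 8)"
      unfolding E1_def a_def r_def s_def
      using largest_gain_bound[OF B(1,3), where 'l = 'l] rs True by (simp add: r_def s_def)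
    moreover have "measure gauss E2 \<le> exp (- (s - r)\<^sup>2 / 8)"
      unfolding E2_def b_def r_def s_def
      using smallest_gain_bound[OF B(1,3), where 'l = 'l] rs True by (simp add: r_def s_def)
    ultimately show ?thesis by simp
  qed
  moreover have "\<Omega> -` T \<inter> space M \<in> sets M" by measurable
  ultimately show ?thesis
    unfolding c_def[symmetric] event r_def[symmetric] s_def[symmetric] by simp
qed

end
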